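(* Let $1<p<\infty$, $L>0$, $a\in\mathcal{A}_p$ and $\rho\in L^1[0,L]$, and let $k\ge1$. Let $\lambda_k^+$ be the $k$-th positive eigenvalue of the problem $$\begin{cases}-(a(x)|u'|^{p-2}u')'=\lambda\rho(x)|u|^{p-2}u, & x\in(0,L),\\ u(0)=u(L)=0.\end{cases}$$ Then $$\frac{k^{p-1}}{p}\left(\int_0^L a^{-\frac{1}{p-1}}(t)\,dt\right)^{1-p}\le \lambda_k^+\cdot\sup_{(c,d)\subset[0,L]}\left|\int_c^d\rho(t)\,dt\right|.$$
   Context: The weight $\rho$ is real-valued and allowed to change sign. The Muckenhoupt class $\mathcal{A}_p$ (in dimension one) is the set of nonnegative functions $a\in L^1_{loc}(\mathbb{R})$ for which there is a constant $c_{p,a}>0$ such that $$\left(\int_B a(x)\,dx\right)\left(\int_B a(x)^{-\frac1{p-1}}\,dx\right)^{p-1}\le c_{p,a}|B|^p$$ for every bounded interval $B\subset\mathbb{R}$ (in particular both integrals are finite, so $a>0$ almost everywhere). Solutions are understood in the usual sense for $L^1$ coefficients: $u$ and $a|u'|^{p-2}u'$ are (after modification on a null set) absolutely continuous on $[0,L]$ and the equation holds almost everywhere. An eigenvalue is a real $\lambda$ for which the problem has a nontrivial solution (an eigenfunction). The positive eigenvalues (which exist when $\rho^+=\max\{\rho,0\}$ is not almost everywhere zero) form an increasing sequence $0<\lambda_1^+<\lambda_2^+<\cdots\to+\infty$; each $\lambda_k^+$ is simple (its eigenfunction $u_k^+$ is unique up to a multiplicative constant), and $u_k^+$ has exactly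 $k+1$ zeros in $[0,L]$, which determine $k$ nodal domains. These are known facts, part of the setting. *)

theory Defs
  imports "HOL-Analysis.Analysis"
begin

(* Absolute continuity of a real function on a compact interval. A division of S is a finite set of
   nonempty compact intervals [Inf K, Sup K] with disjoint interiors and union S, so D ranges over
   all finite families of non-overlapping subintervals. *)
definition abs_cont_on :: "real set \<Rightarrow> (real \<Rightarrow> real) \<Rightarrow> bool" where
  "abs_cont_on X f \<longleftrightarrow>
     (\<forall>e>0. \<exists>\<delta>>0. \<forall>D S. D division_of S \<longrightarrow> S \<subseteq> X \<longrightarrow> (\<Sum>K\<in>D. Sup K - Inf K) < \<delta> \<longrightarrow>
        (\<Sum>K\<in>D. \<bar>f (Sup K) - f (Inf K)\<bar>) < e)"

(* Elements of L^1_loc are classes modulo null sets, hence the almost-everywhere sign condition.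
   Positivity has to be stated: 0 powr r = 0 in HOL, whereas a zero of a makes
   a^(-1/(p-1)) infinite. *)
definition muckenhoupt :: "real \<Rightarrow> (real \<Rightarrow> real) \<Rightarrow> bool" where
  "muckenhoupt p a \<longleftrightarrow>
     (AE x in lebesgue. 0 < a x) \<and>
     (\<forall>c d. a absolutely_integrable_on {c..d}) \<and>
     (\<forall>c d. (\<lambda>x. a x powr (- 1 / (p - 1))) absolutely_integrable_on {c..d}) \<and>
     (\<exists>C>0. \<forall>c d. c < d \<longrightarrow>
        integral {c..d} a * integral {c..d} (\<lambda>x. a x powr (- 1 / (p - 1))) powr (p - 1)
          \<le> C * (d - c) powr p)"

(* |s|^(p-2) s, with value 0 at s = 0 (also for p < 2). *)
definition signed_pow :: "real \<Rightarrow> real \<Rightarrow> real" where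
  "signed_pow p s = \<bar>s\<bar> powr (p - 2) * s"

(* w is the absolutely continuous representative of a |u'|^(p-2) u'; u is its own absolutely
   continuous representative. *)
definition dirichlet_solution ::
  "real \<Rightarrow> real \<Rightarrow> (real \<Rightarrow> real) \<Rightarrow> (real \<Rightarrow> real) \<Rightarrow> real \<Rightarrow> (real \<Rightarrow> real) \<Rightarrow> bool" where
  "dirichlet_solution p L a \<rho> lam u \<longleftrightarrow>
     abs_cont_on {0..L} u \<and>
     (\<exists>w. abs_cont_on {0..L} w \<and>
        (AE x in lebesgue. x \<in> {0<..<L} \<longrightarrow>
           (\<exists>u' w'. (u has_real_derivative u') (at x) \<and>
                    (w has_real_derivative w') (at x) \<and>
                    w x = a x * signed_pow p u' \<and>
                    - w' = lam * \<rho> x * signed_pow p (u x)))) \<and>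
     u 0 = 0 \<and> u L = 0"

definition eigenvalue ::
  "real \<Rightarrow> real \<Rightarrow> (real \<Rightarrow> real) \<Rightarrow> (real \<Rightarrow> real) \<Rightarrow> real \<Rightarrow> bool" where
  "eigenvalue p L a \<rho> lam \<longleftrightarrow>
     (\<exists>u. dirichlet_solution p L a \<rho> lam u \<and> (\<exists>x\<in>{0..L}. u x \<noteq> 0))"

(* k counts from 1: exactly k positive eigenvalues are at most lam, and lam is one of them. *)
definition kth_positive_eigenvalue ::
  "real \<Rightarrow> real \<Rightarrow> (real \<Rightarrow> real) \<Rightarrow> (real \<Rightarrow> real) \<Rightarrow> nat \<Rightarrow> real \<Rightarrow> bool" where
  "kth_positive_eigenvalue p L a \<rho> k lam \<longleftrightarrow>
     0 < lam \<and> eigenvalue p L a \<rho> lam \<and>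
     finite {\<mu>. 0 < \<mu> \<and> \<mu> \<le> lam \<and> eigenvalue p L a \<rho> \<mu>} \<and>
     card {\<mu>. 0 < \<mu> \<and> \<mu> \<le> lam \<and> eigenvalue p L a \<rho> \<mu>} = k"

end

theory Submission
  imports Defs
begin

text \<open>
  Write \<open>\<sigma> = a powr (- 1 / (p - 1))\<close> and let \<open>w\<close> be the flux \<open>a |u'| powr (p - 2) u'\<close>.

  Although \<open>\<rho>\<close> changes sign, Sturm comparison applies to two positive eigenvalues \<open>\<mu> < \<lambda>\<close>: after
  division by the eigenvalue both equations have the same potential \<open>\<rho>\<close> and the ordered leading
  coefficients \<open>a / \<mu> > a / \<lambda>\<close>, so Picone's identity gives the \<open>\<lambda>\<close>-solution a zero strictly between
  any two zeros of the \<open>\<mu>\<close>-solution. Climbing through the \<open>k\<close> positive eigenvalues up to \<open>lam\<close> shows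
  that the last eigenfunction has at least \<open>k + 1\<close> zeros \<open>0 = x\<^sub>0 < \<dots> < x\<^sub>k = L\<close>.

  Between two zeros \<open>c < d\<close>, testing with \<open>u\<close> gives \<open>\<integral> a |u'| powr p = lam \<integral> \<rho> |u| powr p\<close>. The right-hand
  side is at most \<open>lam p S U powr p\<close>, where \<open>U = \<integral> |u'|\<close> and \<open>S\<close> bounds the integrals of \<open>\<rho>\<close> over
  subintervals, because \<open>|u| powr p\<close> has variation at most \<open>p U powr p\<close>; by Jensen's inequality the
  left-hand side is at least \<open>U powr p (\<integral> \<sigma>) powr (1 - p)\<close>. One of the \<open>k\<close> intervals carries at most
  \<open>1 / k\<close> of the total mass of \<open>\<sigma>\<close>.
\<close>

subsection \<open>Absolutely continuous functions\<close>

lemma abs_cont_on_subset: "abs_cont_on X f \<Longrightarrow> Y \<subseteq> X \<Longrightarrow> abs_cont_on Y f"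
  unfolding abs_cont_on_def by (meson order_trans)

text \<open>Gauge arguments produce tagged families, whereas absolute continuity is stated for
  untagged divisions. An interval that carries two tags has empty interior, hence zero increment, so
  forgetting the tags changes neither sum.\<close>

lemma abs_cont_on_tagged:
  assumes "abs_cont_on X f" "0 < e"
  shows "\<exists>d>0. \<forall>q S. q tagged_partial_division_of S \<longrightarrow> \<Union>(snd ` q) \<subseteq> X \<longrightarrow>
    (\<Sum>(x,K)\<in>q. Sup K - Inf K) < d \<longrightarrow> (\<Sum>(x,K)\<in>q. \<bar>f (Sup K) - f (Inf K)\<bar>) < e"
proof -
  obtain d where d: "d > 0" "\<And>D S. D division_of S \<Longrightarrow> S \<subseteq> X \<Longrightarrow> (\<Sum>K\<in>D. Sup K - Inf K) < d \<Longrightarrow>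
        (\<Sum>K\<in>D. \<bar>f (Sup K) - f (Inf K)\<bar>) < e"
    using assms unfolding abs_cont_on_def by meson
  show ?thesis
  proof (intro exI[of _ d] conjI allI impI d(1))
    fix q S assume q: "q tagged_partial_division_of S" "\<Union>(snd ` q) \<subseteq> X" 
      and s: "(\<Sum>(x,K)\<in>q. Sup K - Inf K) < d"
    have q1: "q tagged_division_of \<Union>(snd ` q)"
      using q(1) tagged_partial_division_of_Union_self by blast
    have eq: "(\<Sum>(x,K)\<in>q. \<bar>h (Sup K) - h (Inf K)\<bar>) = (\<Sum>K\<in>snd ` q. \<bar>h (Sup K) - h (Inf K)\<bar>)"
      for h :: "real \<Rightarrow> real"
    proof -
      have ne: "K \<noteq> {}" if "K \<in> snd ` q" for K using tagged_division_ofD(2)[OF q1] that by fastforce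
      \<comment> \<open>The side condition of the sum lemma ranges over all boxes with empty
        interior, including the empty set, where \<open>Sup\<close> and \<open>Inf\<close> say
        nothing useful; hence the value 0 there.\<close>
      let ?d = "\<lambda>K. if K = {} then 0 else \<bar>h (Sup K) - h (Inf K)\<bar>"
      have "?d (cbox u v) = 0" if "box u v = {}" for u v
        using that by (cases "u = v") auto
      then have "(\<Sum>(x,K)\<in>q. ?d K) = (\<Sum>K\<in>snd ` q. ?d K)"
        by (intro sum.over_tagged_division_lemma[OF q1]) blast
      moreover have "(\<Sum>(x,K)\<in>q. ?d K) = (\<Sum>(x,K)\<in>q. \<bar>h (Sup K) - h (Inf K)\<bar>)"
        using ne by (intro sum.cong) force+
      moreover have "(\<Sum>K\<in>snd ` q. ?d K) = (\<Sum>K\<in>snd ` q. \<bar>h (Sup K) - h (Inf K)\<bar>)"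
        using ne by (intro sum.cong) auto
      ultimately show ?thesis by simp
    qed
    have "(\<Sum>(x,K)\<in>q. Sup K - Inf K) = (\<Sum>(x,K)\<in>q. \<bar>Sup K - Inf K\<bar>)"
      using tagged_division_ofD(2,4)[OF q1] by (intro sum.cong) fastforce+
    with s have "(\<Sum>K\<in>snd ` q. \<bar>Sup K - Inf K\<bar>) < d"
      using eq[of "\<lambda>x. x"] by simp
    moreover have "(\<Sum>K\<in>snd ` q. \<bar>Sup K - Inf K\<bar>) = (\<Sum>K\<in>snd ` q. Sup K - Inf K)"
      using tagged_division_ofD(2,4)[OF q1] by (intro sum.cong) fastforce+
    ultimately have "(\<Sum>K\<in>snd ` q. \<bar>f (Sup K) - f (Inf K)\<bar>) < e"
      using d(2)[OF division_of_tagged_division[OF q1] q(2)] by simp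
    then show "(\<Sum>(x,K)\<in>q. \<bar>f (Sup K) - f (Inf K)\<bar>) < e" using eq by simp
  qed
qed

text \<open>
  A gauge argument: tags outside the exceptional null set are controlled by the derivative, and the
  intervals tagged inside it lie in an open set of small measure, where absolute continuity applies.
\<close>

lemma abs_cont_on_integral_le:
  fixes f h :: "real \<Rightarrow> real"
  assumes "c \<le> d" and ac: "abs_cont_on {c..d} f" and h: "h integrable_on {c..d}"
    and ae: "AE x in lebesgue. x \<in> {c<..<d} \<longrightarrow> (\<exists>f'. (f has_real_derivative f') (at x) \<and> h x \<le> f')"
  shows "integral {c..d} h \<le> f d - f c"
proof -
  obtain N0 where N0: "N0 \<in> null_sets lebesgue"
    "\<And>x. x \<notin> N0 \<Longrightarrow> x \<in> {c<..<d} \<longrightarrow> (\<exists>f'. (f has_real_derivative f') (at x) \<and> h x \<le> f')"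
    using ae unfolding completion.AE_iff_null_sets by auto
  \<comment> \<open>The endpoints join the exceptional set because differentiability is only known
    in the open interval.\<close>
  define N where "N = N0 \<union> {c,d}"
  have negN: "negligible N" using N0(1) unfolding N_def
    by (simp add: negligible_iff_null_sets)
  have "\<exists>f'. x \<notin> N \<longrightarrow> x \<in> {c..d} \<longrightarrow> (f has_real_derivative f') (at x) \<and> h x \<le> f'" for x
    using N0(2)[of x] unfolding N_def by auto
  then obtain f' where f': "\<And>x. x \<notin> N \<Longrightarrow> x \<in> {c..d} \<Longrightarrow> (f has_real_derivative f' x) (at x)"
     "\<And>x. x \<notin> N \<Longrightarrow> x \<in> {c..d} \<Longrightarrow> h x \<le> f' x" by metis
  \<comment> \<open>With value 0 on \<open>N\<close>, the intervals tagged in \<open>N\<close>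
    contribute nothing to the Riemann sum; only their increments of \<open>f\<close> remain to be
    estimated.\<close>
  define g where "g x = (if x \<in> N then 0 else h x)" for x
  define I where "I = integral {c..d} h"
  have gI: "(g has_integral I) {c..d}"
    by (rule has_integral_spike[OF negN, of _ _ h]) (auto simp: g_def I_def h integrable_integral)
  \<comment> \<open>The error consists of \<open>e * (d - c)\<close> from differentiability, one
    \<open>e\<close> from the increments over intervals tagged in \<open>N\<close>, and one
    \<open>e\<close> from the Riemann sum.\<close>
  have key: "I \<le> f d - f c + e * (d - c + 2)" if e: "e > 0" for e
  proof -
    obtain dl where dl: "dl > 0" "\<And>q S. q tagged_partial_division_of S \<Longrightarrow> \<Union>(snd ` q) \<subseteq> {c..d} \<Longrightarrow>
      (\<Sum>(x,K)\<in>q. Sup K - Inf K) < dl \<Longrightarrow> (\<Sum>(x,K)\<in>q. \<bar>f (Sup K) - f (Inf K)\<bar>) < e"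
      using abs_cont_on_tagged[OF ac e] by blast
    have Ns: "N \<in> sets lebesgue" using negN by (rule negligible_imp_sets)
    obtain T where T: "open T" "N \<subseteq> T" "T - N \<in> lmeasurable" "emeasure lebesgue (T - N) < ennreal dl"
      using sets_lebesgue_outer_open[OF Ns dl(1)] .
    have TN: "T = N \<union> (T - N)" using T(2) by blast
    have Tl: "T \<in> lmeasurable"
      by (subst TN) (rule fmeasurable.Un[OF negligible_imp_measurable[OF negN] T(3)])
    have "measure lebesgue (T - N) = measure lebesgue T"
      by (rule measure_Diff_null_set) (use negN Tl in \<open>auto simp: negligible_iff_null_sets\<close>)
    then have mT: "measure lebesgue T < dl"
      using T(3,4) dl(1) by (simp add: emeasure_eq_measure2 ennreal_less_iff)
    obtain \<gamma>1 where g1: "gauge \<gamma>1" "\<forall>D. D tagged_division_of {c..d} \<and> \<gamma>1 fine D \<longrightarrow>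
        norm (sum (\<lambda>(x,k). measure lborel k *\<^sub>R g x) D - I) < e"
      using gI[unfolded has_integral_real, rule_format, OF e] by (elim exE conjE)
    have "\<exists>r>0. (x \<in> N \<longrightarrow> ball x r \<subseteq> T) \<and> 
      (x \<notin> N \<longrightarrow> x \<in> {c..d} \<longrightarrow> (\<forall>y. \<bar>y - x\<bar> < r \<longrightarrow> \<bar>f y - f x - f' x * (y - x)\<bar> \<le> e * \<bar>y - x\<bar>))" for x
    proof (cases "x \<in> N")
      case True then show ?thesis using T(1,2) open_contains_ball by (metis subsetD)
    next
      case False
      show ?thesis
      proof (cases "x \<in> {c..d}")
        case True
        then have "(f has_derivative (*) (f' x)) (at x)" using f'(1) False
          by (simp add: has_field_derivative_def)
        then show ?thesis unfolding has_derivative_at_alt using e False by (auto simp: mult.commute)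
      qed (use False in \<open>auto intro: exI[of _ 1]\<close>)
    qed
    then obtain r where r: "\<And>x. r x > 0" "\<And>x. x \<in> N \<Longrightarrow> ball x (r x) \<subseteq> T"
       "\<And>x y. x \<notin> N \<Longrightarrow> x \<in> {c..d} \<Longrightarrow> \<bar>y - x\<bar> < r x \<Longrightarrow> \<bar>f y - f x - f' x * (y - x)\<bar> \<le> e * \<bar>y - x\<bar>"
      by metis
    have gg: "gauge (\<lambda>x. \<gamma>1 x \<inter> ball x (r x))"
      using g1(1) gauge_ball_dependent[of r] r(1) by (auto intro: gauge_Int)
    obtain D where D: "D tagged_division_of {c..d}" "(\<lambda>x. \<gamma>1 x \<inter> ball x (r x)) fine D"
      by (rule fine_division_exists_real[OF gg])
    have fD: "\<gamma>1 fine D" "(\<lambda>x. ball x (r x)) fine D" using D(2) by (auto simp: fine_Int)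
    note tD = tagged_division_ofD[OF D(1)]
    have box: "\<exists>u v. K = {u..v} \<and> u \<le> x \<and> x \<le> v \<and> c \<le> u \<and> v \<le> d \<and> \<bar>u - x\<bar> < r x \<and> \<bar>v - x\<bar> < r x
       \<and> Sup K = v \<and> Inf K = u \<and> measure lborel K = v - u \<and> measure lebesgue K = v - u"
      if xK: "(x,K) \<in> D" for x K
    proof -
      obtain u v where uv: "K = {u..v}" using tD(4)[OF xK] by auto
      have x: "x \<in> K" "K \<subseteq> {c..d}" using tD(2,3)[OF xK] by auto
      then have "u \<le> x" "x \<le> v" "c \<le> u" "v \<le> d" using uv by auto
      moreover have "K \<subseteq> ball x (r x)" using fD(2) xK unfolding fine_def by auto
      then have "u \<in> ball x (r x)" "v \<in> ball x (r x)"
        using uv \<open>u \<le> x\<close> \<open>x \<le> v\<close> by (auto simp del: mem_ball)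
      ultimately show ?thesis using uv by (auto simp: dist_real_def)
    qed
    define Q where "Q = {(x,K)\<in>D. x \<in> N}"
    have finD: "finite D" and QD: "Q \<subseteq> D" using tD(1) by (auto simp: Q_def)
    have Qp: "Q tagged_partial_division_of {c..d}"
      by (rule tagged_partial_division_subset[OF conjunct1[OF D(1)[unfolded tagged_division_of_def]] QD])
    then have Qt: "Q tagged_division_of \<Union>(snd ` Q)"
      by (rule tagged_partial_division_of_Union_self)
    have Qsub: "\<Union>(snd ` Q) \<subseteq> {c..d}" using tD(3) QD by fastforce
    have QT: "\<Union>(snd ` Q) \<subseteq> T"
    proof -
      have "K \<subseteq> T" if "(x,K) \<in> Q" for x K
      proof -
        have "K \<subseteq> ball x (r x)" "x \<in> N" using fD(2) that unfolding fine_def Q_def by auto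
        then show ?thesis using r(2) by blast
      qed
      then show ?thesis by fastforce
    qed
    note Qd = division_of_tagged_division[OF Qt]
    \<comment> \<open>The intervals tagged in \<open>N\<close> do not overlap and lie in
      \<open>T\<close>, so their total length is below \<open>dl\<close>.\<close>
    have "(\<Sum>(x,K)\<in>Q. Sup K - Inf K) = (\<Sum>(x,K)\<in>Q. measure lebesgue K)"
      using box QD by (intro sum.cong) fastforce+
    also have "\<dots> = (\<Sum>K\<in>snd ` Q. measure lebesgue K)"
      by (rule sum.over_tagged_division_lemma[OF Qt]) auto
    also have "\<dots> = measure lebesgue (\<Union>(snd ` Q))"
      by (rule content_division[OF Qd])
    also have "\<dots> \<le> measure lebesgue T"
      by (rule measure_mono_fmeasurable[OF QT _ Tl]) (rule fmeasurableD[OF lmeasurable_division[OF Qd]])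
    finally have "(\<Sum>(x,K)\<in>Q. Sup K - Inf K) < dl" using mT by simp
    then have sQ: "(\<Sum>(x,K)\<in>Q. \<bar>f (Sup K) - f (Inf K)\<bar>) < e"
      using dl(2)[OF Qp Qsub] by blast
    have loc: "measure lborel K * g x - (f (Sup K) - f (Inf K)) \<le> e * (Sup K - Inf K) + 
       (if x \<in> N then \<bar>f (Sup K) - f (Inf K)\<bar> else 0)" if xK: "(x,K) \<in> D" for x K
    proof -
      obtain u v where uv: "K = {u..v}" "u \<le> x" "x \<le> v" "c \<le> u" "v \<le> d" "\<bar>u - x\<bar> < r x" "\<bar>v - x\<bar> < r x"
         "Sup K = v" "Inf K = u" "measure lborel K = v - u" using box[OF xK] by blast
      show ?thesis
      proof (cases "x \<in> N")
        case True
        have "0 \<le> e * (v - u)" using e uv by simp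
        then show ?thesis using True uv by (simp add: g_def)
      next
        case False
        have xc: "x \<in> {c..d}" using uv by auto
        \<comment> \<open>The tag lies between \<open>u\<close> and \<open>v\<close>, so the two
          linearisation errors add up to exactly \<open>e * (v - u)\<close>.\<close>
        have 1: "\<bar>f u - f x - f' x * (u - x)\<bar> \<le> e * (x - u)" using r(3)[OF False xc uv(6)] uv by simp
        have 2: "\<bar>f v - f x - f' x * (v - x)\<bar> \<le> e * (v - x)" using r(3)[OF False xc uv(7)] uv by simp
        have "(v - u) * h x \<le> (v - u) * f' x" using f'(2)[OF False xc] uv by (simp add: mult_left_mono)
        also have "\<dots> \<le> f v - f u + e * (v - u)" using 1 2 by (simp add: algebra_simps abs_le_iff)
        finally show ?thesis using False uv by (simp add: g_def)
      qed
    qed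
    have "(\<Sum>(x,K)\<in>D. measure lborel K * g x) - (f d - f c) = (\<Sum>(x,K)\<in>D. measure lborel K * g x - (f (Sup K) - f (Inf K)))"
      using additive_tagged_division_1[OF assms(1) D(1), of f]
      by (simp add: sum_subtractf case_prod_unfold)
    also have "\<dots> \<le> (\<Sum>(x,K)\<in>D. e * (Sup K - Inf K) + (if x \<in> N then \<bar>f (Sup K) - f (Inf K)\<bar> else 0))"
      using loc by (intro sum_mono) auto
    also have "\<dots> = e * (\<Sum>(x,K)\<in>D. Sup K - Inf K) + (\<Sum>(x,K)\<in>D. (if x \<in> N then \<bar>f (Sup K) - f (Inf K)\<bar> else 0))"
      by (simp add: sum.distrib case_prod_unfold sum_distrib_left)
    also have "(\<Sum>(x,K)\<in>D. Sup K - Inf K) = d - c"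
      using additive_tagged_division_1[OF assms(1) D(1), of "\<lambda>x. x"] by simp
    also have "(\<Sum>(x,K)\<in>D. (if x \<in> N then \<bar>f (Sup K) - f (Inf K)\<bar> else 0)) = (\<Sum>(x,K)\<in>Q. \<bar>f (Sup K) - f (Inf K)\<bar>)"
      unfolding Q_def using finD
      by (intro sum.mono_neutral_cong_right) (auto split: if_splits)
    finally have "(\<Sum>(x,K)\<in>D. measure lborel K * g x) - (f d - f c) \<le> e * (d - c) + e" using sQ by linarith
    moreover have "\<bar>(\<Sum>(x,K)\<in>D. measure lborel K * g x) - I\<bar> < e" using g1(2)[rule_format, OF conjI[OF D(1) fD(1)]] by simp
    ultimately show ?thesis by (simp add: algebra_simps abs_less_iff)
  qed
  have "I \<le> f d - f c"
  proof (rule field_le_epsilon)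
    fix e :: real assume e: "e > 0"
    have "d - c + 2 > 0" using assms(1) by simp
    then show "I \<le> f d - f c + e" using key[of "e / (d - c + 2)"] e by simp
  qed
  then show ?thesis by (simp add: I_def)
qed

lemma abs_cont_on_integral_eq:
  fixes f h :: "real \<Rightarrow> real"
  assumes "c \<le> d" and ac: "abs_cont_on {c..d} f" and h: "h integrable_on {c..d}"
    and ae: "AE x in lebesgue. x \<in> {c<..<d} \<longrightarrow> (f has_real_derivative h x) (at x)"
  shows "integral {c..d} h = f d - f c"
proof (rule antisym)
  show "integral {c..d} h \<le> f d - f c"
    by (rule abs_cont_on_integral_le[OF assms(1-3)]) (use ae in \<open>auto elim: eventually_mono\<close>)
  have "abs_cont_on {c..d} (\<lambda>x. - f x)"
    using ac unfolding abs_cont_on_def by (simp add: abs_minus_commute)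
  then have "integral {c..d} (\<lambda>x. - h x) \<le> - f d - - f c"
    by (rule abs_cont_on_integral_le[OF assms(1)]) 
      (use ae h in \<open>auto elim!: eventually_mono intro: integrable_neg DERIV_minus\<close>)
  then show "f d - f c \<le> integral {c..d} h" by simp
qed

section \<open>Operations preserving absolute continuity\<close>

text \<open>Common source of the closure properties below: a bound on increments passes to sums over
  divisions. Operations on one function take \<open>f = g\<close>.\<close>

lemma abs_cont_on_dominated:
  assumes f: "abs_cont_on X f" and g: "abs_cont_on X g"
    and le: "\<And>x y. x \<in> X \<Longrightarrow> y \<in> X \<Longrightarrow> \<bar>k y - k x\<bar> \<le> C * (\<bar>f y - f x\<bar> + \<bar>g y - g x\<bar>)"
  shows "abs_cont_on X k"
  unfolding abs_cont_on_def
proof (intro allI impI)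
  fix e :: real assume e: "e > 0"
  define C' where "C' = \<bar>C\<bar> + 1"
  have C': "C' > 0" "C \<le> C'" by (auto simp: C'_def)
  define e' where "e' = e / (2 * C')"
  have e': "e' > 0" using e C' by (simp add: e'_def)
  obtain d1 where d1: "d1 > 0" "\<And>D S. D division_of S \<Longrightarrow> S \<subseteq> X \<Longrightarrow> (\<Sum>K\<in>D. Sup K - Inf K) < d1 \<Longrightarrow>
        (\<Sum>K\<in>D. \<bar>f (Sup K) - f (Inf K)\<bar>) < e'"
    using f e' unfolding abs_cont_on_def by meson
  obtain d2 where d2: "d2 > 0" "\<And>D S. D division_of S \<Longrightarrow> S \<subseteq> X \<Longrightarrow> (\<Sum>K\<in>D. Sup K - Inf K) < d2 \<Longrightarrow>
        (\<Sum>K\<in>D. \<bar>g (Sup K) - g (Inf K)\<bar>) < e'"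
    using g e' unfolding abs_cont_on_def by meson
  show "\<exists>d>0. \<forall>D S. D division_of S \<longrightarrow> S \<subseteq> X \<longrightarrow> (\<Sum>K\<in>D. Sup K - Inf K) < d \<longrightarrow>
        (\<Sum>K\<in>D. \<bar>k (Sup K) - k (Inf K)\<bar>) < e"
  proof (intro exI[of _ "min d1 d2"] conjI allI impI)
    show "0 < min d1 d2" using d1 d2 by simp
    fix D S assume D: "D division_of S" "S \<subseteq> X" and s: "(\<Sum>K\<in>D. Sup K - Inf K) < min d1 d2"
    have "\<bar>k (Sup K) - k (Inf K)\<bar> \<le> C' * (\<bar>f (Sup K) - f (Inf K)\<bar> + \<bar>g (Sup K) - g (Inf K)\<bar>)"
      if K: "K \<in> D" for K
    proof -
      obtain u v where uv: "K = cbox u v" using division_ofD(4)[OF D(1) K] by blast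
      have ne: "K \<noteq> {}" "K \<subseteq> X" using division_ofD(2,3)[OF D(1) K] D(2) by auto
      then have "u \<le> v" using uv by auto
      then have "Sup K = v" "Inf K = u" "u \<in> X" "v \<in> X" using ne uv by auto
      then have "\<bar>k (Sup K) - k (Inf K)\<bar> \<le> C * (\<bar>f (Sup K) - f (Inf K)\<bar> + \<bar>g (Sup K) - g (Inf K)\<bar>)"
        using le by blast
      also have "\<dots> \<le> C' * (\<bar>f (Sup K) - f (Inf K)\<bar> + \<bar>g (Sup K) - g (Inf K)\<bar>)"
        using C' by (intro mult_right_mono) auto
      finally show ?thesis .
    qed
    then have "(\<Sum>K\<in>D. \<bar>k (Sup K) - k (Inf K)\<bar>) \<le>
       (\<Sum>K\<in>D. C' * (\<bar>f (Sup K) - f (Inf K)\<bar> + \<bar>g (Sup K) - g (Inf K)\<bar>))"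
      by (rule sum_mono)
    also have "\<dots> = C' * ((\<Sum>K\<in>D. \<bar>f (Sup K) - f (Inf K)\<bar>) + (\<Sum>K\<in>D. \<bar>g (Sup K) - g (Inf K)\<bar>))"
      by (simp add: sum_distrib_left sum.distrib distrib_left)
    also have "\<dots> < C' * (e' + e')"
      using d1(2)[OF D] d2(2)[OF D] s C' by (intro mult_strict_left_mono) auto
    also have "\<dots> = e" using C' by (simp add: e'_def)
    finally show "(\<Sum>K\<in>D. \<bar>k (Sup K) - k (Inf K)\<bar>) < e" .
  qed
qed

lemma abs_cont_on_imp_continuous_on:
  assumes "abs_cont_on {c..d} f"
  shows "continuous_on {c..d} f"
  unfolding continuous_on_iff
proof (intro ballI allI impI)
  fix x e :: real assume x: "x \<in> {c..d}" and e: "e > 0"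
  obtain dl where dl: "dl > 0" "\<And>D S. D division_of S \<Longrightarrow> S \<subseteq> {c..d} \<Longrightarrow> (\<Sum>K\<in>D. Sup K - Inf K) < dl \<Longrightarrow>
        (\<Sum>K\<in>D. \<bar>f (Sup K) - f (Inf K)\<bar>) < e"
    using assms e unfolding abs_cont_on_def by meson
  have *: "\<bar>f v - f u\<bar> < e" if uv: "u \<le> v" "c \<le> u" "v \<le> d" "v - u < dl" for u v
  proof -
    have "{cbox u v} division_of cbox u v" by (rule division_of_self) (use uv in auto)
    from dl(2)[OF this] uv show ?thesis by auto
  qed
  show "\<exists>d'>0. \<forall>x'\<in>{c..d}. dist x' x < d' \<longrightarrow> dist (f x') (f x) < e"
  proof (intro exI[of _ dl] conjI ballI impI dl(1))
    fix y assume y: "y \<in> {c..d}" "dist y x < dl"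
    show "dist (f y) (f x) < e"
    proof (cases "x \<le> y")
      case True then show ?thesis using *[of x y] x y by (auto simp: dist_real_def)
    next
      case False then show ?thesis using *[of y x] x y by (auto simp: dist_real_def abs_minus_commute)
    qed
  qed
qed

lemma abs_cont_on_bounded:
  assumes "abs_cont_on {c..d} f"
  obtains B where "0 < B" "\<And>x. x \<in> {c..d} \<Longrightarrow> \<bar>f x\<bar> \<le> B"
proof -
  have "bounded (f ` {c..d})"
    using abs_cont_on_imp_continuous_on[OF assms] compact_continuous_image compact_imp_bounded by blast
  then show thesis using that unfolding bounded_pos by auto
qed

lemma abs_cont_on_diff:
  assumes "abs_cont_on X f" "abs_cont_on X g"
  shows "abs_cont_on X (\<lambda>x. f x - g x)"
  by (rule abs_cont_on_dominated[OF assms, of _ 1]) auto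

lemma abs_cont_on_cmult:
  assumes "abs_cont_on X f"
  shows "abs_cont_on X (\<lambda>x. C * f x)"
  by (rule abs_cont_on_dominated[OF assms assms, of _ "\<bar>C\<bar>"])
    (auto simp: abs_mult simp flip: right_diff_distrib intro: mult_left_mono)

lemma abs_cont_on_mult:
  assumes f: "abs_cont_on {c..d} f" and g: "abs_cont_on {c..d} g"
  shows "abs_cont_on {c..d} (\<lambda>x. f x * g x)"
proof -
  obtain A where A: "0 < A" "\<And>x. x \<in> {c..d} \<Longrightarrow> \<bar>f x\<bar> \<le> A" using abs_cont_on_bounded[OF f] by blast
  obtain B where B: "0 < B" "\<And>x. x \<in> {c..d} \<Longrightarrow> \<bar>g x\<bar> \<le> B" using abs_cont_on_bounded[OF g] by blast
  show ?thesis
  proof (rule abs_cont_on_dominated[OF f g, of _ "A + B"])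
    fix x y assume xy: "x \<in> {c..d}" "y \<in> {c..d}"
    have "f y * g y - f x * g x = (f y - f x) * g y + f x * (g y - g x)" by (simp add: algebra_simps)
    then have "\<bar>f y * g y - f x * g x\<bar> \<le> \<bar>f y - f x\<bar> * \<bar>g y\<bar> + \<bar>f x\<bar> * \<bar>g y - g x\<bar>"
      by (metis abs_mult abs_triangle_ineq)
    also have "\<dots> \<le> \<bar>f y - f x\<bar> * (A + B) + (A + B) * \<bar>g y - g x\<bar>"
      using A(1) B(1) A(2)[OF xy(1)] B(2)[OF xy(2)] by (intro add_mono mult_mono) auto
    finally show "\<bar>f y * g y - f x * g x\<bar> \<le> (A + B) * (\<bar>f y - f x\<bar> + \<bar>g y - g x\<bar>)"
      by (simp add: algebra_simps)
  qed
qed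

text \<open>A bounded derivative makes \<open>F\<close> Lipschitz on the compact range of
  \<open>g\<close>.\<close>

lemma abs_cont_on_compose_C1:
  fixes F F' :: "real \<Rightarrow> real"
  assumes g: "abs_cont_on X g" and im: "g ` X \<subseteq> {l..u}"
    and F: "\<And>t. t \<in> {l..u} \<Longrightarrow> (F has_real_derivative F' t) (at t)" and F': "continuous_on {l..u} F'"
  shows "abs_cont_on X (\<lambda>x. F (g x))"
proof -
  have "bounded (F' ` {l..u})" using F' compact_continuous_image compact_imp_bounded by blast
  then obtain B where B: "\<And>t. t \<in> {l..u} \<Longrightarrow> norm (F' t) \<le> B" unfolding bounded_pos by blast
  show ?thesis
  proof (rule abs_cont_on_dominated[OF g g, of _ B])
    fix x y assume xy: "x \<in> X" "y \<in> X"
    have m: "g x \<in> {l..u}" "g y \<in> {l..u}" using im xy by auto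
    have "norm (F (g y) - F (g x)) \<le> B * norm (g y - g x)"
      by (rule field_differentiable_bound[of "{l..u}" F F']) 
        (use m B F in \<open>auto intro: has_field_derivative_at_within\<close>)
    moreover have "0 \<le> B * norm (g y - g x)" using B[OF m(1)] by simp
    ultimately show "\<bar>F (g y) - F (g x)\<bar> \<le> B * (\<bar>g y - g x\<bar> + \<bar>g y - g x\<bar>)" by (simp add: algebra_simps)
  qed
qed

subsection \<open>The signed power\<close>

lemma signed_pow_eq: "signed_pow p s = sgn s * \<bar>s\<bar> powr (p - 1)"
proof (cases "s = 0")
  case False
  then have "\<bar>s\<bar> powr (p - 1) = \<bar>s\<bar> powr (p - 2) * \<bar>s\<bar>"
    using powr_add[of "\<bar>s\<bar>" "p - 2" 1] by simp
  then show ?thesis unfolding signed_pow_def by (auto simp: sgn_if)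
qed (simp add: signed_pow_def)

lemma signed_pow_zero [simp]: "signed_pow p 0 = 0"
  by (simp add: signed_pow_def)

lemma signed_pow_minus: "signed_pow p (- s) = - signed_pow p s"
  by (simp add: signed_pow_def)

lemma abs_signed_pow: "\<bar>signed_pow p s\<bar> = \<bar>s\<bar> powr (p - 1)"
  by (cases "s = 0") (auto simp: signed_pow_eq abs_mult abs_sgn_eq)

lemma signed_pow_pos: "0 < s \<Longrightarrow> signed_pow p s = s powr (p - 1)"
  by (simp add: signed_pow_eq)

lemma mult_signed_pow: "s * signed_pow p s = \<bar>s\<bar> powr p"
proof (cases "s = 0")
  case False
  then have "\<bar>s\<bar> powr p = \<bar>s\<bar> powr (p - 1) * \<bar>s\<bar>"
    using powr_add[of "\<bar>s\<bar>" "p - 1" 1] by simp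
  then show ?thesis by (simp add: signed_pow_eq abs_sgn mult_ac)
qed simp

lemma continuous_on_signed_pow:
  assumes "1 < p" "continuous_on S f"
  shows "continuous_on S (\<lambda>x. signed_pow p (f x))"
proof -
  \<comment> \<open>Each part has a nonnegative base and the positive exponent \<open>p - 1\<close>,
    so it is continuous at 0 too, even when \<open>p < 2\<close>.\<close>
  have eq: "signed_pow p s = (max s 0) powr (p - 1) - (max (- s) 0) powr (p - 1)" for s
    using assms(1) by (auto simp: signed_pow_eq max_def sgn_if)
  show ?thesis unfolding eq using assms
    by (intro continuous_on_diff continuous_on_powr' continuous_intros) auto
qed

lemma DERIV_abs_powr:
  fixes p x :: real
  assumes "1 < p"
  shows "((\<lambda>x. \<bar>x\<bar> powr p) has_real_derivative p * signed_pow p x) (at x)"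
proof -
  consider "x > 0" | "x < 0" | "x = 0" by linarith
  then show ?thesis
  proof cases
    case 1
    have "((\<lambda>x. x powr p) has_real_derivative p * x powr (p - 1)) (at x)"
      using has_real_derivative_powr[OF 1] .
    then have "((\<lambda>x. \<bar>x\<bar> powr p) has_real_derivative p * x powr (p - 1)) (at x)"
      by (rule has_field_derivative_transform_within_open[of _ _ _ "{0<..}"]) (use 1 in auto)
    then show ?thesis using 1 by (simp add: signed_pow_pos)
  next
    case 2
    have "((\<lambda>x. (- x) powr p) has_real_derivative (- (p * (- x) powr (p - 1)))) (at x)"
      using 2 by (auto intro!: derivative_eq_intros)
    then have "((\<lambda>x. \<bar>x\<bar> powr p) has_real_derivative (- (p * (- x) powr (p - 1)))) (at x)"
      by (rule has_field_derivative_transform_within_open[of _ _ _ "{..<0}"]) (use 2 in auto)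
    then show ?thesis using 2 by (simp add: signed_pow_eq)
  next
    case 3
    \<comment> \<open>The difference quotient at 0 is \<open>signed_pow p\<close> itself, which
      tends to 0; at \<open>h = 0\<close> both sides are 0 by the convention for division.\<close>
    have "(\<lambda>h::real. \<bar>h\<bar> powr p / h) = (\<lambda>h. signed_pow p h)"
      by (metis (no_types) mult_signed_pow nonzero_mult_div_cancel_left div_by_0 signed_pow_zero)
    moreover have "isCont (signed_pow p) 0"
      using continuous_on_signed_pow[OF assms continuous_on_id, of UNIV]
      by (simp add: continuous_on_eq_continuous_at)
    then have "signed_pow p \<midarrow>0\<rightarrow> 0" by (simp add: isCont_def)
    ultimately show ?thesis using 3 by (simp add: DERIV_def)
  qed
qed

text \<open>The power with exponent \<open>p - 1\<close> is inverted by the one with exponent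
  \<open>1 / (p - 1)\<close>, which is the conjugate exponent minus 1. This solves the flux relation
  for \<open>u'\<close>.\<close>

lemma signed_pow_inverse:
  assumes p: "1 < p" and a: "0 < a" and w: "w = a * signed_pow p s"
  shows "s = signed_pow (p / (p - 1)) w * a powr (- 1 / (p - 1))"
proof -
  have q: "p / (p - 1) - 1 = 1 / (p - 1)" using p by (simp add: field_simps)
  have "\<bar>w\<bar> = a * \<bar>s\<bar> powr (p - 1)" using a by (simp add: w abs_mult abs_signed_pow)
  then have "\<bar>w\<bar> powr (1 / (p - 1)) = a powr (1 / (p - 1)) * \<bar>s\<bar>"
    using a p by (simp add: powr_mult powr_powr)
  moreover have "sgn w = sgn s" using a by (cases "s = 0") (auto simp: w signed_pow_eq sgn_mult)
  moreover have "a powr (1 / (p - 1)) * a powr (- 1 / (p - 1)) = 1"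
    using a by (simp add: powr_add[symmetric] flip: add_divide_distrib)
  ultimately show ?thesis unfolding signed_pow_eq q
    by (metis (no_types, lifting) mult.assoc mult.commute mult.right_neutral sgn_mult_abs)
qed

subsection \<open>Solutions of the half-linear equation\<close>

lemma absolutely_integrable_continuous_mult:
  fixes f g :: "real \<Rightarrow> real"
  assumes "continuous_on {c..d} f" "g absolutely_integrable_on {c..d}"
  shows "(\<lambda>x. f x * g x) absolutely_integrable_on {c..d}"
proof (rule absolutely_integrable_bounded_measurable_product_real)
  show "f \<in> borel_measurable (lebesgue_on {c..d})"
    using assms(1) by (rule continuous_imp_measurable_on_sets_lebesgue) auto
  show "bounded (f ` {c..d})"
    using assms(1) compact_continuous_image compact_imp_bounded by blast
qed (use assms in auto)

locale half_linear =
  fixes p L :: real and \<sigma> \<rho> :: "real \<Rightarrow> real"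
  assumes p: "1 < p" and L: "0 < L"
    and \<sigma>_int: "\<sigma> absolutely_integrable_on {0..L}"
    and \<sigma>_nonneg: "\<And>x. 0 \<le> \<sigma> x" and \<sigma>_pos: "AE x in lebesgue. 0 < \<sigma> x"
    and \<rho>_int: "\<rho> absolutely_integrable_on {0..L}"
begin

text \<open>
  Here \<open>\<sigma>\<close> stands for \<open>a powr (- 1 / (p - 1))\<close> and \<open>w\<close> for the flux, so that \<open>u'\<close> is recovered from
  \<open>w\<close> with the conjugate exponent \<open>p / (p - 1)\<close>.
\<close>

definition sol :: "real \<Rightarrow> (real \<Rightarrow> real) \<Rightarrow> (real \<Rightarrow> real) \<Rightarrow> bool" where
  "sol lam u w \<longleftrightarrow> abs_cont_on {0..L} u \<and> abs_cont_on {0..L} w \<and>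
     (AE x in lebesgue. x \<in> {0<..<L} \<longrightarrow>
        (u has_real_derivative signed_pow (p / (p - 1)) (w x) * \<sigma> x) (at x) \<and>
        (w has_real_derivative - (lam * \<rho> x * signed_pow p (u x))) (at x))"

abbreviation \<psi> where "\<psi> \<equiv> signed_pow (p / (p - 1))"

lemma q: "1 < p / (p - 1)" "p / (p - 1) - 1 = 1 / (p - 1)" "0 < 1 / (p - 1)"
  using p by (simp_all add: field_simps)

lemma signed_pow_\<psi>: "signed_pow p (\<psi> y) = y"
proof -
  have "p / (p - 1) / (p / (p - 1) - 1) = p" using p by (simp add: field_simps)
  then show ?thesis using signed_pow_inverse[OF q(1), of 1 "\<psi> y" y] by simp
qed

lemma subinterval_integrable:
  assumes "0 \<le> x" "y \<le> L"
  shows "\<sigma> absolutely_integrable_on {x..y}" "\<rho> absolutely_integrable_on {x..y}"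
    "\<sigma> integrable_on {x..y}" "\<rho> integrable_on {x..y}" "(\<lambda>t. \<bar>\<rho> t\<bar>) integrable_on {x..y}"
proof -
  have sub: "{x..y} \<subseteq> {0..L}" using assms by auto
  show s: "\<sigma> absolutely_integrable_on {x..y}" "\<rho> absolutely_integrable_on {x..y}"
    by (rule set_integrable_subset[OF \<sigma>_int _ sub] set_integrable_subset[OF \<rho>_int _ sub]; simp)+
  then show "\<sigma> integrable_on {x..y}" "\<rho> integrable_on {x..y}" "(\<lambda>t. \<bar>\<rho> t\<bar>) integrable_on {x..y}"
    by (auto simp: absolutely_integrable_on_def)
qed

lemma solD:
  assumes "sol lam u w"
  shows "abs_cont_on {0..L} u" "abs_cont_on {0..L} w" "continuous_on {0..L} u" "continuous_on {0..L} w"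
  using assms abs_cont_on_imp_continuous_on unfolding sol_def by auto

text \<open>Both signed powers are odd. Later arguments can therefore fix the sign of a solution or
  of its flux.\<close>

lemma sol_uminus:
  assumes "sol lam u w"
  shows "sol lam (\<lambda>x. - u x) (\<lambda>x. - w x)"
proof -
  have "abs_cont_on {0..L} (\<lambda>x. - u x)" "abs_cont_on {0..L} (\<lambda>x. - w x)"
    using abs_cont_on_cmult[of "{0..L}" u "-1"] abs_cont_on_cmult[of "{0..L}" w "-1"] solD[OF assms] by auto
  moreover have "AE x in lebesgue. x \<in> {0<..<L} \<longrightarrow>
        (u has_real_derivative signed_pow (p / (p - 1)) (w x) * \<sigma> x) (at x) \<and>
        (w has_real_derivative - (lam * \<rho> x * signed_pow p (u x))) (at x)"
    using assms by (simp add: sol_def)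
  then have "AE x in lebesgue. x \<in> {0<..<L} \<longrightarrow>
        ((\<lambda>x. - u x) has_real_derivative signed_pow (p / (p - 1)) (- w x) * \<sigma> x) (at x) \<and>
        ((\<lambda>x. - w x) has_real_derivative - (lam * \<rho> x * signed_pow p (- u x))) (at x)"
    by eventually_elim (auto simp: signed_pow_minus intro!: derivative_eq_intros)
  ultimately show ?thesis by (simp add: sol_def)
qed

section \<open>Integral formulas and growth bounds for solutions\<close>

lemma sol_u_diff:
  assumes s: "sol lam u w" and xy: "0 \<le> x" "x \<le> y" "y \<le> L"
  shows "(\<lambda>t. \<psi> (w t) * \<sigma> t) absolutely_integrable_on {x..y}"
    and "integral {x..y} (\<lambda>t. \<psi> (w t) * \<sigma> t) = u y - u x"
proof -
  have sub: "{x..y} \<subseteq> {0..L}" using xy by auto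
  show i: "(\<lambda>t. \<psi> (w t) * \<sigma> t) absolutely_integrable_on {x..y}"
    by (intro absolutely_integrable_continuous_mult continuous_on_signed_pow q(1) 
       continuous_on_subset[OF solD(4)[OF s] sub] subinterval_integrable xy)
  show "integral {x..y} (\<lambda>t. \<psi> (w t) * \<sigma> t) = u y - u x"
  proof (rule abs_cont_on_integral_eq[OF xy(2) abs_cont_on_subset[OF solD(1)[OF s] sub]])
    show "(\<lambda>t. \<psi> (w t) * \<sigma> t) integrable_on {x..y}" using i by (simp add: absolutely_integrable_on_def)
    show "AE t in lebesgue. t \<in> {x<..<y} \<longrightarrow> (u has_real_derivative \<psi> (w t) * \<sigma> t) (at t)"
      using s unfolding sol_def using xy by (elim conjE) (auto elim!: eventually_mono)
  qed
qed

lemma sol_w_diff: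
  assumes s: "sol lam u w" and xy: "0 \<le> x" "x \<le> y" "y \<le> L"
  shows "(\<lambda>t. signed_pow p (u t) * \<rho> t) absolutely_integrable_on {x..y}"
    and "integral {x..y} (\<lambda>t. - lam * (signed_pow p (u t) * \<rho> t)) = w y - w x"
proof -
  have sub: "{x..y} \<subseteq> {0..L}" using xy by auto
  show i: "(\<lambda>t. signed_pow p (u t) * \<rho> t) absolutely_integrable_on {x..y}"
    by (intro absolutely_integrable_continuous_mult continuous_on_signed_pow p 
       continuous_on_subset[OF solD(3)[OF s] sub] subinterval_integrable xy)
  show "integral {x..y} (\<lambda>t. - lam * (signed_pow p (u t) * \<rho> t)) = w y - w x"
  proof (rule abs_cont_on_integral_eq[OF xy(2) abs_cont_on_subset[OF solD(2)[OF s] sub]])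
    show "(\<lambda>t. - lam * (signed_pow p (u t) * \<rho> t)) integrable_on {x..y}"
      using i by (intro integrable_on_mult_right) (simp add: absolutely_integrable_on_def)
    show "AE t in lebesgue. t \<in> {x<..<y} \<longrightarrow> (w has_real_derivative - lam * (signed_pow p (u t) * \<rho> t)) (at t)"
      using s unfolding sol_def using xy by (elim conjE) (auto elim!: eventually_mono simp: mult_ac)
  qed
qed

lemma sol_u_bound:
  assumes s: "sol lam u w" and xy: "0 \<le> x" "x \<le> y" "y \<le> L"
    and W: "\<And>t. t \<in> {x..y} \<Longrightarrow> \<bar>w t\<bar> \<le> W"
  shows "\<bar>u y - u x\<bar> \<le> W powr (1 / (p - 1)) * integral {x..y} \<sigma>"
proof -
  have "norm (integral {x..y} (\<lambda>t. \<psi> (w t) * \<sigma> t)) \<le> integral {x..y} (\<lambda>t. W powr (1 / (p - 1)) * \<sigma> t)"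
  proof (rule integral_norm_bound_integral)
    show "(\<lambda>t. \<psi> (w t) * \<sigma> t) integrable_on {x..y}"
      using sol_u_diff(1)[OF s xy] by (simp add: absolutely_integrable_on_def)
    show "(\<lambda>t. W powr (1 / (p - 1)) * \<sigma> t) integrable_on {x..y}"
      by (intro integrable_on_mult_right subinterval_integrable xy)
    fix t assume "t \<in> {x..y}"
    then show "norm (\<psi> (w t) * \<sigma> t) \<le> W powr (1 / (p - 1)) * \<sigma> t"
      using q p \<sigma>_nonneg[of t] W[of t]
      by (auto simp: abs_mult abs_signed_pow intro!: mult_right_mono powr_mono2)
  qed
  then show ?thesis using sol_u_diff(2)[OF s xy] by simp
qed

text \<open>Counterpart of the upper bound: both measure growth by the same integral of
  \<open>\<sigma>\<close>, so that two solutions become comparable.\<close>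

lemma sol_u_lower:
  assumes s: "sol lam u w" and xy: "0 \<le> x" "x \<le> y" "y \<le> L"
    and W: "\<And>t. t \<in> {x..y} \<Longrightarrow> m \<le> w t" and m: "0 < m"
  shows "m powr (1 / (p - 1)) * integral {x..y} \<sigma> \<le> u y - u x"
proof -
  have "integral {x..y} (\<lambda>t. m powr (1 / (p - 1)) * \<sigma> t) \<le> integral {x..y} (\<lambda>t. \<psi> (w t) * \<sigma> t)"
  proof (rule integral_le)
    show "(\<lambda>t. \<psi> (w t) * \<sigma> t) integrable_on {x..y}"
      using sol_u_diff(1)[OF s xy] by (simp add: absolutely_integrable_on_def)
    show "(\<lambda>t. m powr (1 / (p - 1)) * \<sigma> t) integrable_on {x..y}"
      by (intro integrable_on_mult_right subinterval_integrable xy)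
    fix t assume "t \<in> {x..y}"
    then show "m powr (1 / (p - 1)) * \<sigma> t \<le> \<psi> (w t) * \<sigma> t"
      using q p \<sigma>_nonneg[of t] W[of t] m
      by (auto simp: signed_pow_pos intro!: mult_right_mono powr_mono2)
  qed
  then show ?thesis using sol_u_diff(2)[OF s xy] by simp
qed

lemma sol_w_bound:
  assumes s: "sol lam u w" and xy: "0 \<le> x" "x \<le> y" "y \<le> L"
    and M: "\<And>t. t \<in> {x..y} \<Longrightarrow> \<bar>u t\<bar> \<le> M"
  shows "\<bar>w y - w x\<bar> \<le> \<bar>lam\<bar> * M powr (p - 1) * integral {x..y} (\<lambda>t. \<bar>\<rho> t\<bar>)"
proof -
  have "norm (integral {x..y} (\<lambda>t. - lam * (signed_pow p (u t) * \<rho> t)))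
      \<le> integral {x..y} (\<lambda>t. \<bar>lam\<bar> * M powr (p - 1) * \<bar>\<rho> t\<bar>)"
  proof (rule integral_norm_bound_integral)
    show "(\<lambda>t. - lam * (signed_pow p (u t) * \<rho> t)) integrable_on {x..y}"
      using sol_w_diff(1)[OF s xy] by (intro integrable_on_mult_right) (simp add: absolutely_integrable_on_def)
    show "(\<lambda>t. \<bar>lam\<bar> * M powr (p - 1) * \<bar>\<rho> t\<bar>) integrable_on {x..y}"
      by (intro integrable_on_mult_right subinterval_integrable xy)
    fix t assume "t \<in> {x..y}"
    then show "norm (- lam * (signed_pow p (u t) * \<rho> t)) \<le> \<bar>lam\<bar> * M powr (p - 1) * \<bar>\<rho> t\<bar>"
      using p M[of t]
      by (auto simp: abs_mult abs_signed_pow mult.assoc intro!: mult_left_mono mult_right_mono powr_mono2)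
  qed
  then show ?thesis using sol_w_diff(2)[OF s xy] by simp
qed

section \<open>Uniqueness for zero Cauchy data\<close>

lemma subinterval_integral_mono:
  assumes "0 \<le> \<alpha>" "\<alpha> \<le> x" "y \<le> \<beta>" "\<beta> \<le> L"
  shows "integral {x..y} \<sigma> \<le> integral {\<alpha>..\<beta>} \<sigma>" "integral {x..y} (\<lambda>t. \<bar>\<rho> t\<bar>) \<le> integral {\<alpha>..\<beta>} (\<lambda>t. \<bar>\<rho> t\<bar>)"
  using assms \<sigma>_nonneg by (auto intro!: integral_subset_le subinterval_integrable)

text \<open>
  The equation is homogeneous: zero Cauchy data at \<open>c\<close> make the maximum \<open>M\<close> of \<open>|u|\<close> satisfy
  \<open>M \<le> M / 2\<close> on a short interval, although the nonlinearity is not Lipschitz.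
\<close>

lemma sol_zero_local:
  assumes s: "sol lam u w" and c: "0 \<le> \<alpha>" "\<alpha> \<le> c" "c \<le> \<beta>" "\<beta> \<le> L" "u c = 0" "w c = 0"
    and small: "(\<bar>lam\<bar> * integral {0..L} (\<lambda>t. \<bar>\<rho> t\<bar>)) powr (1 / (p - 1)) * integral {\<alpha>..\<beta>} \<sigma> \<le> 1 / 2"
    and t: "t \<in> {\<alpha>..\<beta>}"
  shows "u t = 0 \<and> w t = 0"
proof -
  define R where "R = integral {0..L} (\<lambda>t. \<bar>\<rho> t\<bar>)"
  have R: "0 \<le> R" unfolding R_def using subinterval_integrable(5)[of 0 L] by (auto intro!: integral_nonneg)
  have "continuous_on {\<alpha>..\<beta>} (\<lambda>x. \<bar>u x\<bar>)"
    using continuous_on_subset[OF solD(3)[OF s]] c by (intro continuous_intros) auto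
  then obtain t0 where t0: "t0 \<in> {\<alpha>..\<beta>}" "\<And>x. x \<in> {\<alpha>..\<beta>} \<Longrightarrow> \<bar>u x\<bar> \<le> \<bar>u t0\<bar>"
    using continuous_attains_sup[of "{\<alpha>..\<beta>}" "\<lambda>x. \<bar>u x\<bar>"] c by auto
  define M where "M = \<bar>u t0\<bar>"
  define W where "W = \<bar>lam\<bar> * M powr (p - 1) * R"
  have sub: "\<And>s. s \<in> {min x c..max x c} \<Longrightarrow> s \<in> {\<alpha>..\<beta>}" if "x \<in> {\<alpha>..\<beta>}" for x
    using that c by (auto simp: min_def max_def split: if_splits)
  have w: "\<bar>w x\<bar> \<le> W" if x: "x \<in> {\<alpha>..\<beta>}" for x
  proof -
    have "\<bar>w (max x c) - w (min x c)\<bar> \<le> \<bar>lam\<bar> * M powr (p - 1) * integral {min x c..max x c} (\<lambda>t. \<bar>\<rho> t\<bar>)"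
      by (rule sol_w_bound[OF s]) (use c x t0(2)[folded M_def, OF sub[OF x]] in auto)
    also have "\<dots> \<le> W" unfolding W_def R_def
      by (intro mult_left_mono subinterval_integral_mono) (use c x in auto)
    finally show ?thesis using c by (auto simp: max_def min_def split: if_splits)
  qed
  have "\<bar>u (max t0 c) - u (min t0 c)\<bar> \<le> W powr (1 / (p - 1)) * integral {min t0 c..max t0 c} \<sigma>"
    by (rule sol_u_bound[OF s]) (use c t0(1) w[OF sub[OF t0(1)]] in auto)
  also have "\<dots> \<le> W powr (1 / (p - 1)) * integral {\<alpha>..\<beta>} \<sigma>"
    by (intro mult_left_mono subinterval_integral_mono) (use c t0 in auto)
  \<comment> \<open>Homogeneity enters here: the power \<open>1 / (p - 1)\<close> turns
    \<open>M powr (p - 1)\<close> back into \<open>M\<close>, so the estimate is linear in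
    \<open>M\<close>.\<close>
  also have "W powr (1 / (p - 1)) = (\<bar>lam\<bar> * R) powr (1 / (p - 1)) * M"
    using p R by (simp add: W_def M_def powr_mult powr_powr mult_ac)
  also have "(\<bar>lam\<bar> * R) powr (1 / (p - 1)) * M * integral {\<alpha>..\<beta>} \<sigma> \<le> M * (1 / 2)"
    using mult_left_mono[OF small, of M] by (simp add: M_def R_def mult_ac)
  finally have "M \<le> M / 2" using c by (auto simp: M_def max_def min_def split: if_splits)
  then have M: "M = 0" by (simp add: M_def)
  then have "u t = 0" using t0(2)[OF t] by (simp add: M_def)
  moreover have "w t = 0" using w[OF t] M p by (simp add: W_def)
  ultimately show ?thesis by simp
qed

text \<open>The primitive of \<open>\<sigma>\<close> is continuous on a compact interval, hence
  uniformly continuous; so \<open>\<delta>\<close> does not depend on the position of the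
  interval.\<close>

lemma integral_\<sigma>_small:
  assumes "0 < e"
  obtains \<delta> where "0 < \<delta>" "\<And>x y. 0 \<le> x \<Longrightarrow> x \<le> y \<Longrightarrow> y \<le> L \<Longrightarrow> y - x < \<delta> \<Longrightarrow> integral {x..y} \<sigma> < e"
proof -
  have "continuous_on {0..L} (\<lambda>x. integral {0..x} \<sigma>)"
    using indefinite_integral_continuous_1 subinterval_integrable(3)[of 0 L] by auto
  then have "uniformly_continuous_on {0..L} (\<lambda>x. integral {0..x} \<sigma>)"
    by (simp add: compact_uniformly_continuous)
  then obtain \<delta> where d: "0 < \<delta>" "\<And>x y. x \<in> {0..L} \<Longrightarrow> y \<in> {0..L} \<Longrightarrow> dist y x < \<delta> \<Longrightarrow>
     dist (integral {0..y} \<sigma>) (integral {0..x} \<sigma>) < e"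
    using assms unfolding uniformly_continuous_on_def by meson
  show thesis
  proof (rule that[OF d(1)])
    fix x y assume xy: "0 \<le> x" "x \<le> y" "y \<le> L" "y - x < \<delta>"
    have "integral {0..x} \<sigma> + integral {x..y} \<sigma> = integral {0..y} \<sigma>"
      by (rule Henstock_Kurzweil_Integration.integral_combine) (use xy subinterval_integrable in auto)
    moreover have "dist (integral {0..y} \<sigma>) (integral {0..x} \<sigma>) < e"
      by (rule d(2)) (use xy in \<open>auto simp: dist_real_def\<close>)
    ultimately show "integral {x..y} \<sigma> < e" by (simp add: dist_real_def abs_if split: if_splits)
  qed
qed

text \<open>The local statement works on intervals of a uniform length, so zero Cauchy data spread
  from \<open>c\<close> over the whole interval in finitely many steps.\<close>

lemma sol_unique_zero:
  assumes s: "sol lam u w" and c: "c \<in> {0..L}" "u c = 0" "w c = 0" and t: "t \<in> {0..L}"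
  shows "u t = 0"
proof -
  define K where "K = (\<bar>lam\<bar> * integral {0..L} (\<lambda>t. \<bar>\<rho> t\<bar>)) powr (1 / (p - 1))"
  have K: "0 \<le> K" by (simp add: K_def)
  \<comment> \<open>The threshold makes \<open>K\<close> times the integral at most
    \<open>1 / 2\<close>; the added 1 covers \<open>K = 0\<close>.\<close>
  obtain \<delta> where d: "0 < \<delta>" "\<And>x y. 0 \<le> x \<Longrightarrow> x \<le> y \<Longrightarrow> y \<le> L \<Longrightarrow> y - x < \<delta> \<Longrightarrow> integral {x..y} \<sigma> < 1 / (2 * (K + 1))"
    using integral_\<sigma>_small[of "1 / (2 * (K + 1))"] K by auto
  have step: "u y = 0 \<and> w y = 0" if "x \<in> {0..L}" "y \<in> {0..L}" "\<bar>x - y\<bar> < \<delta>" "u x = 0" "w x = 0" for x y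
  proof (rule sol_zero_local[OF s, of "min x y" x "max x y"])
    have "integral {min x y..max x y} \<sigma> \<le> 1 / (2 * (K + 1))"
      by (rule less_imp_le[OF d(2)]) (use that in auto)
    then have "K * integral {min x y..max x y} \<sigma> \<le> K * (1 / (2 * (K + 1)))"
      using K by (rule mult_left_mono)
    also have "\<dots> \<le> 1 / 2" using K by (simp add: field_simps)
    finally show "(\<bar>lam\<bar> * integral {0..L} (\<lambda>t. \<bar>\<rho> t\<bar>)) powr (1 / (p - 1)) * integral {min x y..max x y} \<sigma> \<le> 1 / 2"
      by (simp add: K_def)
  qed (use that in auto)
  have "\<forall>x\<in>{0..L}. \<bar>x - c\<bar> \<le> real n * (\<delta> / 2) \<longrightarrow> u x = 0 \<and> w x = 0" for n
  proof (induction n)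
    case 0 then show ?case using c by auto
  next
    case (Suc n)
    show ?case
    proof (intro ballI impI)
      fix x assume x: "x \<in> {0..L}" "\<bar>x - c\<bar> \<le> real (Suc n) * (\<delta> / 2)"
      \<comment> \<open>The point half a \<open>\<delta>\<close> closer to \<open>c\<close>, without
        passing \<open>c\<close>; the induction hypothesis applies there.\<close>
      define y where "y = (if c \<le> x then max c (x - \<delta> / 2) else min c (x + \<delta> / 2))"
      have y: "y \<in> {0..L}" "\<bar>y - x\<bar> < \<delta>" "\<bar>y - c\<bar> \<le> real n * (\<delta> / 2)"
        using x c(1) d(1) by (auto simp: y_def algebra_simps abs_if max_def min_def split: if_splits)
      then show "u x = 0 \<and> w x = 0" using Suc step[of y x] x(1) by blast
    qed
  qed
  moreover obtain n where "\<bar>t - c\<bar> / (\<delta> / 2) \<le> real n" using real_arch_simple by blast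
  then have "\<bar>t - c\<bar> \<le> real n * (\<delta> / 2)" using d(1) by (simp add: pos_divide_le_eq)
  ultimately show ?thesis using t by blast
qed

section \<open>Two solutions near a common zero\<close>

text \<open>Near \<open>c\<close> the flux \<open>z\<close> stays above a positive constant, so
  \<open>|v|\<close> is at least a multiple of the integral of \<open>\<sigma>\<close> from
  \<open>c\<close>, while \<open>|u|\<close> is at most a multiple of the same integral.\<close>

lemma sol_compare_zero_pos:
  assumes s: "sol mu u w" and s': "sol lam v z" and c: "c \<in> {0..L}" "u c = 0" "v c = 0" and z: "0 < z c"
  shows "\<exists>K \<delta>. 0 < K \<and> 0 < \<delta> \<and> (\<forall>x\<in>{0..L}. \<bar>x - c\<bar> < \<delta> \<longrightarrow> \<bar>u x\<bar> \<le> K * \<bar>v x\<bar>)"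
proof -
  obtain W where W: "0 < W" "\<And>x. x \<in> {0..L} \<Longrightarrow> \<bar>w x\<bar> \<le> W"
    using abs_cont_on_bounded[OF solD(2)[OF s]] by blast
  define m where "m = z c / 2"
  have m: "0 < m" using z by (simp add: m_def)
  obtain \<delta> where d: "0 < \<delta>" "\<And>x. x \<in> {0..L} \<Longrightarrow> dist x c < \<delta> \<Longrightarrow> dist (z x) (z c) < m"
    using solD(4)[OF s'] c(1) m unfolding continuous_on_iff by meson
  have zm: "m \<le> z x" if "x \<in> {0..L}" "\<bar>x - c\<bar> < \<delta>" for x
    using d(2)[of x] that by (auto simp: dist_real_def m_def abs_if split: if_splits)
  define r where "r = 1 / (p - 1)"
  show ?thesis
  proof (rule exI[of _ "W powr r / m powr r"], rule exI[of _ \<delta>], intro conjI ballI impI d(1))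
    show "0 < W powr r / m powr r" using W m by simp
    fix x assume x: "x \<in> {0..L}" "\<bar>x - c\<bar> < \<delta>"
    let ?I = "integral {min x c..max x c} \<sigma>"
    have sub: "s \<in> {0..L}" "\<bar>s - c\<bar> < \<delta>" if "s \<in> {min x c..max x c}" for s
      using that c x by (auto simp: min_def max_def split: if_splits)
    have "\<bar>u (max x c) - u (min x c)\<bar> \<le> W powr r * ?I" unfolding r_def
      by (rule sol_u_bound[OF s]) (use x c W(2)[OF sub(1)] in auto)
    then have 1: "\<bar>u x\<bar> \<le> W powr r * ?I" using c by (auto simp: max_def min_def split: if_splits)
    have zm': "m \<le> z s" if "s \<in> {min x c..max x c}" for s using zm sub[OF that] by blast
    have "m powr r * ?I \<le> v (max x c) - v (min x c)" unfolding r_def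
      by (rule sol_u_lower[OF s' _ _ _ zm' m]) (use x c in auto)
    then have 2: "m powr r * ?I \<le> \<bar>v x\<bar>" using c by (auto simp: max_def min_def split: if_splits)
    have "W powr r * ?I = (W powr r / m powr r) * (m powr r * ?I)" using m by simp
    also have "\<dots> \<le> (W powr r / m powr r) * \<bar>v x\<bar>" using 2 W m by (intro mult_left_mono) auto
    finally show "\<bar>u x\<bar> \<le> (W powr r / m powr r) * \<bar>v x\<bar>" using 1 by simp
  qed
qed

lemma sol_compare_zero:
  assumes s: "sol mu u w" and s': "sol lam v z" and c: "c \<in> {0..L}" "u c = 0" "v c = 0" and z: "z c \<noteq> 0"
  shows "\<exists>K \<delta>. 0 < K \<and> 0 < \<delta> \<and> (\<forall>x\<in>{0..L}. \<bar>x - c\<bar> < \<delta> \<longrightarrow> \<bar>u x\<bar> \<le> K * \<bar>v x\<bar>)"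
proof (cases "0 < z c")
  case True then show ?thesis using sol_compare_zero_pos[OF s s' c] by simp
next
  case False then show ?thesis using sol_compare_zero_pos[OF s sol_uminus[OF s'] c(1,2)] c z by simp
qed

end

subsection \<open>Picone identity and Sturm comparison\<close>

lemma Young_powr:
  fixes p x y :: real
  assumes p: "1 < p" and "0 \<le> x" "0 \<le> y"
  shows "p * (x * y powr (p - 1)) \<le> x powr p + (p - 1) * y powr p"
proof -
  have "x * y powr (p - 1) \<le> x powr p / p + (y powr (p - 1)) powr (p / (p - 1)) / (p / (p - 1))"
    by (rule Youngs_inequality) (use assms in \<open>auto simp: field_simps\<close>)
  also have "(y powr (p - 1)) powr (p / (p - 1)) = y powr p" using p by (simp add: powr_powr)
  finally have "p * (x * y powr (p - 1)) \<le> p * (x powr p / p + y powr p / (p / (p - 1)))"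
    using p by simp
  also have "\<dots> = x powr p + (p - 1) * y powr p" using p by (simp add: field_simps)
  finally show ?thesis .
qed

text \<open>Pointwise form of Picone's inequality. Up to a factor \<open>\<sigma>\<close>,
  \<open>s\<close> and \<open>t\<close> play the roles of \<open>u'\<close> and \<open>v'\<close>;
  the left-hand side is then \<open>signed_pow p t\<close> times the derivative of
  \<open>|u| powr p * v powr (1 - p)\<close>.\<close>

lemma picone_ineq:
  fixes p s t u v :: real
  assumes p: "1 < p" and v: "0 < v"
  shows "p * signed_pow p u * s * signed_pow p t * v powr (1 - p)
    - (p - 1) * \<bar>u\<bar> powr p * \<bar>t\<bar> powr p * v powr (- p) \<le> \<bar>s\<bar> powr p"
proof -
  \<comment> \<open>Young's inequality for \<open>|s|\<close> and this \<open>y\<close> is the claim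
    once signs are discarded.\<close>
  define y where "y = \<bar>u\<bar> * \<bar>t\<bar> / v"
  have y: "0 \<le> y" using v by (simp add: y_def)
  have y1: "y powr (p - 1) = \<bar>u\<bar> powr (p - 1) * \<bar>t\<bar> powr (p - 1) * v powr (1 - p)"
    using v powr_minus[of v "p - 1"] by (simp add: y_def powr_mult powr_divide field_simps)
  have y2: "y powr p = \<bar>u\<bar> powr p * \<bar>t\<bar> powr p * v powr (- p)"
    using v by (simp add: y_def powr_mult powr_divide powr_minus field_simps)
  have "p * signed_pow p u * s * signed_pow p t * v powr (1 - p)
     \<le> \<bar>p * signed_pow p u * s * signed_pow p t * v powr (1 - p)\<bar>" by (rule abs_ge_self)
  also have "\<dots> = p * (\<bar>s\<bar> * y powr (p - 1))"
    using p by (simp add: abs_mult abs_signed_pow y1 mult_ac)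
  also have "\<dots> \<le> \<bar>s\<bar> powr p + (p - 1) * y powr p" by (rule Young_powr) (use p y in auto)
  finally show ?thesis by (simp add: y2 mult.assoc)
qed

context half_linear begin

text \<open>A zero integral would force the nonnegative \<open>\<sigma>\<close> to vanish almost
  everywhere on an interval of positive measure.\<close>

lemma integral_\<sigma>_pos:
  assumes "0 \<le> x" "x < y" "y \<le> L"
  shows "0 < integral {x..y} \<sigma>"
proof -
  have s: "set_integrable lebesgue {x..y} \<sigma>" using subinterval_integrable(1) assms by auto
  have "integral {x..y} \<sigma> \<noteq> 0"
  proof
    assume "integral {x..y} \<sigma> = 0"
    then have "(LINT t:{x..y}|lebesgue. \<sigma> t) = 0"
      using set_lebesgue_integral_eq_integral(2)[OF s] by simp
    then have "AE t in lebesgue. indicat_real {x..y} t *\<^sub>R \<sigma> t = 0"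
      unfolding set_lebesgue_integral_def
      using s integral_nonneg_eq_0_iff_AE[of lebesgue "\<lambda>t. indicat_real {x..y} t *\<^sub>R \<sigma> t"] \<sigma>_nonneg
      by (simp add: set_integrable_def)
    then have "AE t in lebesgue. t \<notin> {x..y}"
      using \<sigma>_pos by eventually_elim (auto simp: indicator_def split: if_splits)
    then have "{x..y} \<in> null_sets lebesgue" by (subst (asm) AE_iff_null_sets[symmetric]) auto
    then have "emeasure lebesgue {x..y} = 0" by auto
    then show False using assms by simp
  qed
  moreover have "0 \<le> integral {x..y} \<sigma>" using \<sigma>_nonneg assms by (intro integral_nonneg subinterval_integrable) auto
  ultimately show ?thesis by simp
qed

text \<open>Controls the quotient \<open>u / v\<close> near a zero \<open>e\<close> of
  \<open>u\<close>, as the Picone function requires. If \<open>v\<close> also vanishes at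
  \<open>e\<close>, uniqueness gives a nonzero flux there and the comparison applies; otherwise
  \<open>v\<close> stays away from 0.\<close>

lemma sol_dominated:
  assumes s: "sol mu u w" and s': "sol lam v z" and e: "e \<in> {0..L}" "u e = 0"
    and nz: "\<exists>x\<in>{0..L}. v x \<noteq> 0"
  shows "\<exists>K \<delta>. 0 < K \<and> 0 < \<delta> \<and> (\<forall>x\<in>{0..L}. \<bar>x - e\<bar> < \<delta> \<longrightarrow> \<bar>u x\<bar> \<le> K * \<bar>v x\<bar>)"
proof (cases "v e = 0")
  case True
  then have "z e \<noteq> 0" using sol_unique_zero[OF s' e(1)] nz by blast
  then show ?thesis using sol_compare_zero[OF s s' e True] by blast
next
  case False
  define m where "m = \<bar>v e\<bar> / 2"
  have m: "0 < m" using False by (simp add: m_def)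
  obtain \<delta> where d: "0 < \<delta>" "\<And>x. x \<in> {0..L} \<Longrightarrow> dist x e < \<delta> \<Longrightarrow> dist (v x) (v e) < m"
    using solD(3)[OF s'] e(1) m unfolding continuous_on_iff by meson
  obtain B where B: "0 < B" "\<And>x. x \<in> {0..L} \<Longrightarrow> \<bar>u x\<bar> \<le> B"
    using abs_cont_on_bounded[OF solD(1)[OF s]] by blast
  show ?thesis
  proof (rule exI[of _ "B / m"], rule exI[of _ \<delta>], intro conjI ballI impI d(1))
    show "0 < B / m" using B m by simp
    fix x assume x: "x \<in> {0..L}" "\<bar>x - e\<bar> < \<delta>"
    have "m \<le> \<bar>v x\<bar>" using d(2)[of x] x unfolding dist_real_def m_def by linarith
    then have "B \<le> B / m * \<bar>v x\<bar>" using B(1) m by (simp add: field_simps)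
    then show "\<bar>u x\<bar> \<le> B / m * \<bar>v x\<bar>" using B(2)[OF x(1)] by linarith
  qed
qed

text \<open>
  The \<open>\<rho>\<close>-terms in the derivative of this function cancel, since each flux is divided by its own
  eigenvalue.
\<close>

definition picone :: "real \<Rightarrow> real \<Rightarrow> (real \<Rightarrow> real) \<Rightarrow> (real \<Rightarrow> real) \<Rightarrow> (real \<Rightarrow> real) \<Rightarrow> (real \<Rightarrow> real) \<Rightarrow> real \<Rightarrow> real"
  where "picone mu lam u w v z x = u x * w x / mu - \<bar>u x\<bar> powr p * (z x * v x powr (1 - p)) / lam"

lemma picone_deriv:
  assumes ml: "0 < mu" "mu < lam" and v: "0 < v x"
    and du: "(u has_real_derivative \<psi> (w x) * \<sigma> x) (at x)"
    and dw: "(w has_real_derivative - (mu * \<rho> x * signed_pow p (u x))) (at x)"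
    and dv: "(v has_real_derivative \<psi> (z x) * \<sigma> x) (at x)"
    and dz: "(z has_real_derivative - (lam * \<rho> x * signed_pow p (v x))) (at x)"
  shows "\<exists>F'. (picone mu lam u w v z has_real_derivative F') (at x) \<and>
     (1 / mu - 1 / lam) * (\<bar>\<psi> (w x)\<bar> powr p * \<sigma> x) \<le> F'"
proof -
  define s where "s = \<psi> (w x)"
  define t where "t = \<psi> (z x)"
  have w: "w x = signed_pow p s" and z: "z x = signed_pow p t"
    by (simp_all add: s_def t_def signed_pow_\<psi>)
  define F' where "F' = (s * \<sigma> x * w x + - (mu * \<rho> x * signed_pow p (u x)) * u x) / mu -
    ((p * signed_pow p (u x) * (s * \<sigma> x)) * (z x * v x powr (1 - p)) +
     (- (lam * \<rho> x * signed_pow p (v x)) * v x powr (1 - p) + ((1 - p) * v x powr (- p) * (t * \<sigma> x)) * z x) * \<bar>u x\<bar> powr p) / lam"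
  have d1: "((\<lambda>x. \<bar>u x\<bar> powr p) has_real_derivative p * signed_pow p (u x) * (s * \<sigma> x)) (at x)"
    using DERIV_chain2[OF DERIV_abs_powr[OF p] du] by (simp add: s_def)
  have "((\<lambda>y. y powr (1 - p)) has_real_derivative (1 - p) * v x powr (- p)) (at (v x))"
    using has_real_derivative_powr[OF v, of "1 - p"] by simp
  from DERIV_chain2[OF this dv]
  have d2: "((\<lambda>x. v x powr (1 - p)) has_real_derivative (1 - p) * v x powr (- p) * (t * \<sigma> x)) (at x)"
    by (simp add: t_def)
  have "(picone mu lam u w v z has_real_derivative F') (at x)"
    unfolding picone_def[abs_def] F'_def
    by (intro DERIV_diff DERIV_cdivide DERIV_mult d1 d2 dw dz du[folded s_def])
  moreover have "(1 / mu - 1 / lam) * (\<bar>s\<bar> powr p * \<sigma> x) \<le> F'"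
  proof -
    have vv: "signed_pow p (v x) * v x powr (1 - p) = 1"
      using v by (simp add: signed_pow_pos powr_add[symmetric])
    have uu: "signed_pow p (u x) * u x = \<bar>u x\<bar> powr p" "s * w x = \<bar>s\<bar> powr p" "t * z x = \<bar>t\<bar> powr p"
      using mult_signed_pow[of "u x" p] mult_signed_pow[of s p] mult_signed_pow[of t p]
      by (simp_all add: w z mult.commute)
    define P where "P = p * signed_pow p (u x) * s * signed_pow p t * v x powr (1 - p)
      - (p - 1) * \<bar>u x\<bar> powr p * \<bar>t\<bar> powr p * v x powr (- p)"
    \<comment> \<open>Grouping isolates the two \<open>\<rho>\<close>-terms: both reduce to
      \<open>\<rho> x * |u x| powr p\<close>, with opposite signs.\<close>
    have "F' = (s * w x) * \<sigma> x / mu - \<rho> x * (signed_pow p (u x) * u x) -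
      (p * signed_pow p (u x) * s * z x * v x powr (1 - p) * \<sigma> x - (p - 1) * \<bar>u x\<bar> powr p * (t * z x) * v x powr (- p) * \<sigma> x) / lam 
       + \<rho> x * (signed_pow p (v x) * v x powr (1 - p)) * \<bar>u x\<bar> powr p"
      using ml by (simp add: F'_def field_simps)
    also have "\<dots> = \<sigma> x * (\<bar>s\<bar> powr p / mu - P / lam)"
      unfolding uu vv P_def z[symmetric] by (simp add: field_simps diff_divide_distrib)
    finally have F: "F' = \<sigma> x * (\<bar>s\<bar> powr p / mu - P / lam)" .
    have "P \<le> \<bar>s\<bar> powr p" unfolding P_def by (rule picone_ineq[OF p v])
    then have "P / lam \<le> \<bar>s\<bar> powr p / lam" using ml by (simp add: divide_right_mono)
    then have "\<sigma> x * (\<bar>s\<bar> powr p / mu - \<bar>s\<bar> powr p / lam) \<le> F'"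
      unfolding F using \<sigma>_nonneg[of x] by (intro mult_left_mono) auto
    then show ?thesis by (simp add: algebra_simps)
  qed
  ultimately show ?thesis unfolding s_def by blast
qed

lemma picone_mono:
  assumes s: "sol mu u w" and s': "sol lam v z" and ml: "0 < mu" "mu < lam"
    and xy: "0 \<le> x" "x \<le> y" "y \<le> L" and pos: "\<And>t. t \<in> {x..y} \<Longrightarrow> 0 < v t"
  shows "(\<lambda>t. \<bar>\<psi> (w t)\<bar> powr p * \<sigma> t) integrable_on {x..y}"
    "(1 / mu - 1 / lam) * integral {x..y} (\<lambda>t. \<bar>\<psi> (w t)\<bar> powr p * \<sigma> t)
      \<le> picone mu lam u w v z y - picone mu lam u w v z x"
proof -
  have sub: "{x..y} \<subseteq> {0..L}" using xy by auto
  note ac = abs_cont_on_subset[OF _ sub]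
  show i: "(\<lambda>t. \<bar>\<psi> (w t)\<bar> powr p * \<sigma> t) integrable_on {x..y}"
  proof -
    have "continuous_on {x..y} (\<lambda>t. \<bar>\<psi> (w t)\<bar> powr p)"
      using p by (intro continuous_on_powr' continuous_intros continuous_on_signed_pow q(1) 
         continuous_on_subset[OF solD(4)[OF s] sub]) auto
    then show ?thesis
      using absolutely_integrable_continuous_mult subinterval_integrable(1) xy
      by (meson absolutely_integrable_on_def)
  qed
  have cv: "continuous_on {x..y} v" by (rule continuous_on_subset[OF solD(3)[OF s'] sub])
  \<comment> \<open>The minimum of \<open>v\<close> is positive, so \<open>v\<close> takes its
    values in a compact interval on which \<open>t powr (1 - p)\<close> is continuously
    differentiable.\<close>
  obtain t0 where t0: "t0 \<in> {x..y}" "\<And>t. t \<in> {x..y} \<Longrightarrow> v t0 \<le> v t"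
    using continuous_attains_inf[OF _ _ cv] xy by auto
  obtain B where B: "\<And>t. t \<in> {x..y} \<Longrightarrow> \<bar>v t\<bar> \<le> B"
    using abs_cont_on_bounded[OF ac[OF solD(1)[OF s']]] by blast
  obtain A where A: "\<And>t. t \<in> {x..y} \<Longrightarrow> \<bar>u t\<bar> \<le> A"
    using abs_cont_on_bounded[OF ac[OF solD(1)[OF s]]] by blast
  have acv: "abs_cont_on {x..y} (\<lambda>t. v t powr (1 - p))"
  proof (rule abs_cont_on_compose_C1[where F = "\<lambda>t. t powr (1 - p)"])
    show "abs_cont_on {x..y} v" by (rule ac[OF solD(1)[OF s']])
    show "v ` {x..y} \<subseteq> {v t0..B}" using t0 B by force
    show "((\<lambda>t. t powr (1 - p)) has_real_derivative (1 - p) * t powr (1 - p - 1)) (at t)"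
      if "t \<in> {v t0..B}" for t
      using that pos[OF t0(1)] by (intro has_real_derivative_powr) auto
    show "continuous_on {v t0..B} (\<lambda>t. (1 - p) * t powr (1 - p - 1))"
      using pos[OF t0(1)] by (intro continuous_intros) auto
  qed
  have acu: "abs_cont_on {x..y} (\<lambda>t. \<bar>u t\<bar> powr p)"
  proof (rule abs_cont_on_compose_C1[where F = "\<lambda>t. \<bar>t\<bar> powr p"])
    show "abs_cont_on {x..y} u" by (rule ac[OF solD(1)[OF s]])
    show "u ` {x..y} \<subseteq> {-A..A}" using A by (force simp: abs_le_iff)
    show "continuous_on {-A..A} (\<lambda>t. p * signed_pow p t)"
      by (intro continuous_intros continuous_on_signed_pow p)
  qed (rule DERIV_abs_powr[OF p])
  have "abs_cont_on {x..y} (\<lambda>t. 1 / mu * (u t * w t) - 1 / lam * (\<bar>u t\<bar> powr p * (z t * v t powr (1 - p))))"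
    by (intro abs_cont_on_diff abs_cont_on_cmult abs_cont_on_mult acu acv ac solD(1,2)[OF s] solD(1,2)[OF s'])
  then have acF: "abs_cont_on {x..y} (picone mu lam u w v z)" by (simp add: picone_def[abs_def])
  have "integral {x..y} (\<lambda>t. (1 / mu - 1 / lam) * (\<bar>\<psi> (w t)\<bar> powr p * \<sigma> t))
      \<le> picone mu lam u w v z y - picone mu lam u w v z x"
  proof (rule abs_cont_on_integral_le[OF xy(2) acF integrable_on_mult_right[OF i]])
    have 1: "AE x in lebesgue. x \<in> {0<..<L} \<longrightarrow>
        (u has_real_derivative \<psi> (w x) * \<sigma> x) (at x) \<and>
        (w has_real_derivative - (mu * \<rho> x * signed_pow p (u x))) (at x)" using s by (simp add: sol_def)
    have 2: "AE x in lebesgue. x \<in> {0<..<L} \<longrightarrow>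
        (v has_real_derivative \<psi> (z x) * \<sigma> x) (at x) \<and>
        (z has_real_derivative - (lam * \<rho> x * signed_pow p (v x))) (at x)" using s' by (simp add: sol_def)
    from 1 2 show "AE t in lebesgue. t \<in> {x<..<y} \<longrightarrow>
      (\<exists>F'. (picone mu lam u w v z has_real_derivative F') (at t) \<and>
         (1 / mu - 1 / lam) * (\<bar>\<psi> (w t)\<bar> powr p * \<sigma> t) \<le> F')"
    proof eventually_elim
      case (elim t)
      show ?case
      proof
        assume t: "t \<in> {x<..<y}"
        then have "t \<in> {0<..<L}" "0 < v t" using xy pos by auto
        then show "\<exists>F'. (picone mu lam u w v z has_real_derivative F') (at t) \<and>
         (1 / mu - 1 / lam) * (\<bar>\<psi> (w t)\<bar> powr p * \<sigma> t) \<le> F'"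
          using elim by (intro picone_deriv ml) auto
      qed
    qed
  qed
  then show "(1 / mu - 1 / lam) * integral {x..y} (\<lambda>t. \<bar>\<psi> (w t)\<bar> powr p * \<sigma> t)
      \<le> picone mu lam u w v z y - picone mu lam u w v z x" by simp
qed

text \<open>The factor \<open>v powr (1 - p)\<close> may blow up at \<open>e\<close>, but
  \<open>|u| \<le> K v\<close> gives
  \<open>|u| powr p * v powr (1 - p) \<le> K powr (p - 1) * |u|\<close>. Hence the Picone function
  is at most a multiple of \<open>|u|\<close> and tends to 0 with it.\<close>

lemma picone_endpoint:
  assumes s: "sol mu u w" and s': "sol lam v z" and ml: "0 < mu" "0 < lam"
    and cd: "0 \<le> c" "c < d" "d \<le> L" and pos: "\<And>t. t \<in> {c<..<d} \<Longrightarrow> 0 < v t"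
    and e: "e = c \<or> e = d" "u e = 0" and eps: "0 < \<epsilon>" "0 < \<eta>"
  shows "\<exists>x\<in>{c<..<d}. \<bar>x - e\<bar> < \<eta> \<and> \<bar>picone mu lam u w v z x\<bar> < \<epsilon>"
proof -
  have e0: "e \<in> {0..L}" using e cd by auto
  have mid: "(c + d) / 2 \<in> {c<..<d}" using cd by auto
  have "v ((c + d) / 2) \<noteq> 0" using pos[OF mid] by simp
  moreover have "(c + d) / 2 \<in> {0..L}" using cd by auto
  ultimately have nz: "\<exists>x\<in>{0..L}. v x \<noteq> 0" by blast
  obtain K \<delta> where K: "0 < K" "0 < \<delta>" "\<And>x. x \<in> {0..L} \<Longrightarrow> \<bar>x - e\<bar> < \<delta> \<Longrightarrow> \<bar>u x\<bar> \<le> K * \<bar>v x\<bar>"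
    using sol_dominated[OF s s' e0 e(2) nz] by blast
  obtain W where W: "0 < W" "\<And>x. x \<in> {0..L} \<Longrightarrow> \<bar>w x\<bar> \<le> W"
    using abs_cont_on_bounded[OF solD(2)[OF s]] by blast
  obtain Z where Z: "0 < Z" "\<And>x. x \<in> {0..L} \<Longrightarrow> \<bar>z x\<bar> \<le> Z"
    using abs_cont_on_bounded[OF solD(2)[OF s']] by blast
  define C where "C = W / mu + K powr (p - 1) * Z / lam"
  have C: "0 < C" using W Z ml by (simp add: C_def add_pos_nonneg)
  have bound: "\<bar>picone mu lam u w v z x\<bar> \<le> C * \<bar>u x\<bar>" if x: "x \<in> {c<..<d}" "\<bar>x - e\<bar> < \<delta>" for x
  proof -
    have xL: "x \<in> {0..L}" and vx: "0 < v x" using x cd pos by auto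
    have "\<bar>u x\<bar> powr p = \<bar>u x\<bar> * \<bar>u x\<bar> powr (p - 1)"
      using mult_signed_pow[of "\<bar>u x\<bar>" p] abs_signed_pow[of p "\<bar>u x\<bar>"]
      by (cases "u x = 0") (auto simp: signed_pow_pos)
    also have "\<dots> \<le> \<bar>u x\<bar> * (K * v x) powr (p - 1)"
      using K(3)[OF xL x(2)] vx p by (intro mult_left_mono powr_mono2) auto
    finally have "\<bar>u x\<bar> powr p * v x powr (1 - p) \<le> \<bar>u x\<bar> * (K * v x) powr (p - 1) * v x powr (1 - p)"
      by (rule mult_right_mono) auto
    also have "\<dots> = \<bar>u x\<bar> * K powr (p - 1) * (v x powr (p - 1) * v x powr (1 - p))"
      using K vx by (simp add: powr_mult)
    also have "v x powr (p - 1) * v x powr (1 - p) = 1" using vx by (simp add: powr_add[symmetric])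
    finally have 1: "\<bar>u x\<bar> powr p * v x powr (1 - p) \<le> \<bar>u x\<bar> * K powr (p - 1)" by simp
    have "\<bar>picone mu lam u w v z x\<bar> \<le> \<bar>u x * w x / mu\<bar> + \<bar>\<bar>u x\<bar> powr p * (z x * v x powr (1 - p)) / lam\<bar>"
      unfolding picone_def by (rule abs_triangle_ineq4)
    also have "\<dots> = \<bar>u x\<bar> * \<bar>w x\<bar> / mu + (\<bar>u x\<bar> powr p * v x powr (1 - p)) * \<bar>z x\<bar> / lam"
      using ml by (simp add: abs_mult mult_ac)
    also have "\<dots> \<le> \<bar>u x\<bar> * W / mu + (\<bar>u x\<bar> * K powr (p - 1)) * Z / lam"
    proof (intro add_mono divide_right_mono)
      show "\<bar>u x\<bar> * \<bar>w x\<bar> \<le> \<bar>u x\<bar> * W" using W(2)[OF xL] by (simp add: mult_left_mono)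
      show "\<bar>u x\<bar> powr p * v x powr (1 - p) * \<bar>z x\<bar> \<le> \<bar>u x\<bar> * K powr (p - 1) * Z"
        by (rule mult_mono[OF 1 Z(2)[OF xL]]) auto
    qed (use ml in auto)
    also have "\<dots> = C * \<bar>u x\<bar>" by (simp add: C_def algebra_simps)
    finally show ?thesis .
  qed
  obtain \<delta>2 where d2: "0 < \<delta>2" "\<And>x. x \<in> {0..L} \<Longrightarrow> dist x e < \<delta>2 \<Longrightarrow> dist (u x) (u e) < \<epsilon> / C"
    using solD(3)[OF s] e0 divide_pos_pos[OF eps(1) C] unfolding continuous_on_iff by meson
  define r where "r = min (min \<delta> \<delta>2) (min \<eta> (d - c)) / 2"
  have r: "0 < r" "r < \<delta>" "r < \<delta>2" "r < \<eta>" "r < d - c"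
    using K d2(1) eps cd by (auto simp: r_def min_def)
  define x where "x = (if e = c then c + r else d - r)"
  have x: "x \<in> {c<..<d}" "\<bar>x - e\<bar> = r" using r e(1) by (auto simp: x_def)
  have "\<bar>u x\<bar> < \<epsilon> / C" using d2(2)[of x] x r cd e(2) by (auto simp: dist_real_def)
  then have "C * \<bar>u x\<bar> < \<epsilon>" using C by (simp add: field_simps)
  then show ?thesis using bound[OF x(1)] x r by (intro bexI[of _ x]) auto
qed

text \<open>The Picone function is nondecreasing on \<open>(c, d)\<close> and has arbitrarily small
  values near both ends, so it is both nonnegative and nonpositive. It would thus be constant, yet
  it increases strictly near \<open>c\<close>, where the flux of \<open>u\<close> is
  nonzero.\<close>

lemma sturm_pos:
  assumes s: "sol mu u w" and s': "sol lam v z" and ml: "0 < mu" "mu < lam"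
    and cd: "0 \<le> c" "c < d" "d \<le> L" and u: "u c = 0" "u d = 0" and nz: "\<exists>x\<in>{0..L}. u x \<noteq> 0"
    and pos: "\<And>t. t \<in> {c<..<d} \<Longrightarrow> 0 < v t"
  shows False
proof -
  let ?F = "picone mu lam u w v z"
  have lam: "0 < lam" using ml by simp
  have k: "0 < 1 / mu - 1 / lam" using ml by (simp add: frac_less2)
  have I: "(\<lambda>t. \<bar>\<psi> (w t)\<bar> powr p * \<sigma> t) integrable_on {x..y}"
      "(1 / mu - 1 / lam) * integral {x..y} (\<lambda>t. \<bar>\<psi> (w t)\<bar> powr p * \<sigma> t) \<le> ?F y - ?F x"
    if "c < x" "x \<le> y" "y < d" for x y
    using that cd by (intro picone_mono[OF s s' ml] pos; auto)+
  have mono: "?F x \<le> ?F y" if xy: "c < x" "x \<le> y" "y < d" for x y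
  proof -
    have "0 \<le> integral {x..y} (\<lambda>t. \<bar>\<psi> (w t)\<bar> powr p * \<sigma> t)"
      by (rule integral_nonneg[OF I(1)[OF xy]]) (use \<sigma>_nonneg in auto)
    then show ?thesis using I(2)[OF xy] k by (smt (verit) mult_nonneg_nonneg)
  qed
  have Fpos: "0 \<le> ?F x" if x: "c < x" "x < d" for x
  proof (rule ccontr)
    assume "\<not> 0 \<le> ?F x"
    then obtain y where "y \<in> {c<..<d}" "\<bar>y - c\<bar> < x - c" "\<bar>?F y\<bar> < - ?F x"
      using picone_endpoint[OF s s' ml(1) lam cd pos _ u(1), of "- ?F x" "x - c"] x by auto
    then show False using mono[of y x] x by auto
  qed
  have Fneg: "?F x \<le> 0" if x: "c < x" "x < d" for x
  proof (rule ccontr)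
    assume "\<not> ?F x \<le> 0"
    then obtain y where "y \<in> {c<..<d}" "\<bar>y - d\<bar> < d - x" "\<bar>?F y\<bar> < ?F x"
      using picone_endpoint[OF s s' ml(1) lam cd pos _ u(2), of "?F x" "d - x"] x by auto
    then show False using mono[of x y] x by auto
  qed
  have cL: "c \<in> {0..L}" using cd by auto
  have "w c \<noteq> 0" using sol_unique_zero[OF s cL u(1)] nz by blast
  define m where "m = \<bar>w c\<bar> / 2"
  have m: "0 < m" using \<open>w c \<noteq> 0\<close> by (simp add: m_def)
  obtain \<delta> where d: "0 < \<delta>" "\<And>x. x \<in> {0..L} \<Longrightarrow> dist x c < \<delta> \<Longrightarrow> dist (w x) (w c) < m"
    using solD(4)[OF s] cL m unfolding continuous_on_iff by meson
  define r where "r = min \<delta> (d - c)"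
  have r: "0 < r" "r \<le> \<delta>" "r \<le> d - c" using d(1) cd by (auto simp: r_def)
  \<comment> \<open>Both points lie inside \<open>(c, d)\<close> and within \<open>\<delta>\<close>
    of \<open>c\<close>, so \<open>|w| \<ge> m\<close> between them.\<close>
  define x y where "x = c + r / 3" and "y = c + r / 2"
  have xy: "c < x" "x < y" "y < d" using r by (auto simp: x_def y_def)
  define \<kappa> where "\<kappa> = (m powr (1 / (p - 1))) powr p"
  have \<kappa>: "0 < \<kappa>" using m by (simp add: \<kappa>_def)
  have "\<kappa> * integral {x..y} \<sigma> = integral {x..y} (\<lambda>t. \<kappa> * \<sigma> t)" by simp
  also have "\<dots> \<le> integral {x..y} (\<lambda>t. \<bar>\<psi> (w t)\<bar> powr p * \<sigma> t)"
  proof (rule integral_le)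
    show "(\<lambda>t. \<kappa> * \<sigma> t) integrable_on {x..y}" by (intro integrable_on_mult_right subinterval_integrable) (use xy cd in auto)
    show "(\<lambda>t. \<bar>\<psi> (w t)\<bar> powr p * \<sigma> t) integrable_on {x..y}" by (rule I(1)) (use xy in auto)
    fix t assume t: "t \<in> {x..y}"
    then have "t \<in> {0..L}" "dist t c < \<delta>" using xy cd r by (auto simp: dist_real_def x_def y_def)
    then have "m \<le> \<bar>w t\<bar>" using d(2)[of t] unfolding dist_real_def m_def by linarith
    then have "m powr (1 / (p - 1)) \<le> \<bar>\<psi> (w t)\<bar>"
      unfolding abs_signed_pow q(2) using m p by (intro powr_mono2) auto
    then have "\<kappa> \<le> \<bar>\<psi> (w t)\<bar> powr p" unfolding \<kappa>_def using p by (intro powr_mono2) auto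
    then show "\<kappa> * \<sigma> t \<le> \<bar>\<psi> (w t)\<bar> powr p * \<sigma> t" using \<sigma>_nonneg by (intro mult_right_mono) auto
  qed
  finally have "\<kappa> * integral {x..y} \<sigma> \<le> integral {x..y} (\<lambda>t. \<bar>\<psi> (w t)\<bar> powr p * \<sigma> t)" .
  moreover have "0 < \<kappa> * integral {x..y} \<sigma>" using \<kappa> integral_\<sigma>_pos[of x y] xy cd by simp
  ultimately have "0 < integral {x..y} (\<lambda>t. \<bar>\<psi> (w t)\<bar> powr p * \<sigma> t)" by linarith
  then have "0 < (1 / mu - 1 / lam) * integral {x..y} (\<lambda>t. \<bar>\<psi> (w t)\<bar> powr p * \<sigma> t)" using k by simp
  moreover have "?F y \<le> 0" "0 \<le> ?F x" using Fpos Fneg xy by auto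
  ultimately show False using I(2)[of x y] xy by linarith
qed

text \<open>Without a zero in \<open>(c, d)\<close> the continuous \<open>v\<close> has constant
  sign there, and \<open>v\<close> or \<open>-v\<close> falls under the positive case.\<close>

lemma sturm:
  assumes s: "sol mu u w" and s': "sol lam v z" and ml: "0 < mu" "mu < lam"
    and cd: "0 \<le> c" "c < d" "d \<le> L" and u: "u c = 0" "u d = 0" and nz: "\<exists>x\<in>{0..L}. u x \<noteq> 0"
  shows "\<exists>x. c < x \<and> x < d \<and> v x = 0"
proof (rule ccontr)
  assume "\<not> ?thesis"
  then have n0: "v x \<noteq> 0" if "x \<in> {c<..<d}" for x using that by auto
  have con: "continuous_on {c<..<d} v" by (rule continuous_on_subset[OF solD(3)[OF s']]) (use cd in auto)
  then have "connected (v ` {c<..<d})" by (rule connected_continuous_image) simp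
  then have iv: "is_interval (v ` {c<..<d})" by (simp add: is_interval_connected_1)
  have "(\<forall>x\<in>{c<..<d}. 0 < v x) \<or> (\<forall>x\<in>{c<..<d}. v x < 0)"
  proof (rule ccontr)
    assume "\<not> ?thesis"
    then obtain x y where "x \<in> {c<..<d}" "y \<in> {c<..<d}" "v x \<le> 0" "0 \<le> v y" by (meson not_le)
    then have "0 \<in> v ` {c<..<d}" using iv unfolding is_interval_1 by blast
    then show False using n0 by auto
  qed
  then show False
  proof
    assume "\<forall>x\<in>{c<..<d}. 0 < v x" then show False using sturm_pos[OF s s' ml cd u nz] by blast
  next
    assume "\<forall>x\<in>{c<..<d}. v x < 0" 
    then have "\<And>t. t \<in> {c<..<d} \<Longrightarrow> 0 < - v t" by simp
    then show False using sturm_pos[OF s sol_uminus[OF s'] ml cd u nz] by blast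
  qed
qed

end

subsection \<open>The Lyapunov inequality\<close>

text \<open>Finitely many steps of length at most \<open>\<delta> / 2\<close> lead from
  \<open>c\<close> to \<open>d\<close>.\<close>

lemma locally_antimono_imp_le:
  fixes H :: "real \<Rightarrow> real"
  assumes \<delta>: "0 < \<delta>" and H: "\<And>x y. c \<le> x \<Longrightarrow> x \<le> y \<Longrightarrow> y \<le> d \<Longrightarrow> y - x < \<delta> \<Longrightarrow> H y \<le> H x"
    and cd: "c \<le> d"
  shows "H d \<le> H c"
proof -
  have "\<forall>y\<in>{c..d}. y - c \<le> real n * (\<delta> / 2) \<longrightarrow> H y \<le> H c" for n
  proof (induction n)
    case 0 then show ?case by auto
  next
    case (Suc n)
    show ?case
    proof (intro ballI impI)
      fix y assume y: "y \<in> {c..d}" "y - c \<le> real (Suc n) * (\<delta> / 2)"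
      define x where "x = max c (y - \<delta> / 2)"
      have x: "x \<in> {c..d}" "x - c \<le> real n * (\<delta> / 2)" "x \<le> y" "y - x < \<delta>"
        using y \<delta> by (auto simp: x_def max_def algebra_simps)
      then have "H x \<le> H c" "H y \<le> H x" using Suc H[of x y] y by auto
      then show "H y \<le> H c" by simp
    qed
  qed
  moreover obtain n where "(d - c) / (\<delta> / 2) \<le> real n" using real_arch_simple by blast
  then have "d - c \<le> real n * (\<delta> / 2)" using \<delta> by (simp add: pos_divide_le_eq)
  ultimately show ?thesis using cd by auto
qed

lemma strict_chain_le:
  fixes x :: "nat \<Rightarrow> 'a :: preorder"
  assumes "\<And>i. i < n \<Longrightarrow> x i < x (Suc i)" "i \<le> j" "j \<le> n"
  shows "x i \<le> x j"
  using assms(2,3)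
proof (induction j rule: dec_induct)
  case (step m)
  then show ?case using assms(1)[of m] by (auto dest: less_imp_le order_trans)
qed simp

text \<open>
  Integration by parts without derivatives: on short intervals the increments of
  \<open>\<integral> g r - g (\<integral> r)\<close> are dominated by those of \<open>S V\<close>.
\<close>

lemma integral_mult_le_variation:
  fixes r g V :: "real \<Rightarrow> real"
  assumes cd: "c \<le> d" and r: "r absolutely_integrable_on {c..d}" and g: "continuous_on {c..d} g" and gd: "g d = 0"
    and S: "\<And>x. x \<in> {c..d} \<Longrightarrow> \<bar>integral {c..x} r\<bar> \<le> S"
    and V: "\<And>x y. c \<le> x \<Longrightarrow> x \<le> y \<Longrightarrow> y \<le> d \<Longrightarrow> \<bar>g y - g x\<bar> \<le> V y - V x"
  shows "integral {c..d} (\<lambda>x. g x * r x) \<le> S * (V d - V c)"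
proof -
  define R where "R x = integral {c..x} r" for x
  define P where "P x = integral {c..x} (\<lambda>t. \<bar>r t\<bar>)" for x
  \<comment> \<open>The integral minus the boundary term of the integration by parts:
    \<open>F c = 0\<close>, and \<open>F d\<close> is the full integral because
    \<open>g d = 0\<close>.\<close>
  define F where "F x = integral {c..x} (\<lambda>t. g t * r t) - g x * R x" for x
  have gr: "(\<lambda>t. g t * r t) absolutely_integrable_on {c..d}"
    by (rule absolutely_integrable_continuous_mult[OF g r])
  have ints: "r integrable_on {c..d}" "(\<lambda>t. \<bar>r t\<bar>) integrable_on {c..d}" "(\<lambda>t. g t * r t) integrable_on {c..d}"
    using r gr by (auto simp: absolutely_integrable_on_def)
  have sub: "h integrable_on {x..y}" if "h integrable_on {c..d}" "c \<le> x" "y \<le> d" for h :: "real \<Rightarrow> real" and x y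
    by (rule integrable_on_subinterval[OF that(1)]) (use that in auto)
  have comb: "integral {c..y} h = integral {c..x} h + integral {x..y} h"
    if "h integrable_on {c..d}" "c \<le> x" "x \<le> y" "y \<le> d" for h :: "real \<Rightarrow> real" and x y
    by (rule Henstock_Kurzweil_Integration.integral_combine[symmetric]) (use that sub in auto)
  have key: "F d \<le> F c + (e * P d + S * (V d - V c))" if e: "0 < e" for e
  proof -
    have "uniformly_continuous_on {c..d} g" using g by (simp add: compact_uniformly_continuous)
    then obtain \<delta> where d: "0 < \<delta>" "\<And>x y. x \<in> {c..d} \<Longrightarrow> y \<in> {c..d} \<Longrightarrow> dist y x < \<delta> \<Longrightarrow> dist (g y) (g x) < e"
      using e unfolding uniformly_continuous_on_def by meson
    have "F d - e * P d - S * V d \<le> F c - e * P c - S * V c"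
    proof (rule locally_antimono_imp_le[OF d(1) _ cd])
      fix x y assume xy: "c \<le> x" "x \<le> y" "y \<le> d" "y - x < \<delta>"
      have i: "integral {x..y} (\<lambda>t. (g t - g y) * r t) = integral {x..y} (\<lambda>t. g t * r t) - g y * integral {x..y} r"
        using sub[OF ints(3)] sub[OF ints(1)] xy
        by (simp add: left_diff_distrib integral_diff integrable_on_mult_right)
      have gi: "(\<lambda>t. (g t - g y) * r t) integrable_on {x..y}"
        using sub[OF ints(3)] sub[OF ints(1)] xy
        by (simp add: left_diff_distrib integrable_diff integrable_on_mult_right)
      have "norm (integral {x..y} (\<lambda>t. (g t - g y) * r t)) \<le> integral {x..y} (\<lambda>t. e * \<bar>r t\<bar>)"
      proof (rule integral_norm_bound_integral[OF gi])
        show "(\<lambda>t. e * \<bar>r t\<bar>) integrable_on {x..y}" using sub[OF ints(2)] xy by (simp add: integrable_on_mult_right)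
        fix t assume t: "t \<in> {x..y}"
        then have "dist (g t) (g y) < e" by (intro d(2)) (use xy in \<open>auto simp: dist_real_def\<close>)
        then show "norm ((g t - g y) * r t) \<le> e * \<bar>r t\<bar>"
          by (auto simp: dist_real_def abs_mult intro: mult_right_mono)
      qed
      also have "\<dots> = e * (P y - P x)" using comb[OF ints(2) xy(1-3)] by (simp add: P_def)
      finally have 1: "\<bar>integral {x..y} (\<lambda>t. (g t - g y) * r t)\<bar> \<le> e * (P y - P x)" by simp
      have "\<bar>R x * (g y - g x)\<bar> \<le> S * (V y - V x)"
        unfolding abs_mult R_def using S[of x] V[OF xy(1-3)] xy by (intro mult_mono) auto
      \<comment> \<open>The first term is an error controlled by the oscillation of \<open>g\<close>
        and the increment of \<open>P\<close>; the second is bounded by \<open>S\<close> times the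
        increment of \<open>V\<close>.\<close>
      moreover have "F y - F x = integral {x..y} (\<lambda>t. (g t - g y) * r t) - R x * (g y - g x)"
        unfolding F_def i R_def comb[OF ints(3) xy(1-3)] comb[OF ints(1) xy(1-3)] by (simp add: algebra_simps)
      ultimately show "F y - e * P y - S * V y \<le> F x - e * P x - S * V x"
        using 1 by (simp add: algebra_simps)
    qed
    moreover have "P c = 0" by (simp add: P_def)
    ultimately show ?thesis by (simp add: algebra_simps)
  qed
  have P: "0 \<le> P d" unfolding P_def by (rule integral_nonneg[OF ints(2)]) simp
  have "F d \<le> F c + S * (V d - V c)"
  proof (rule field_le_epsilon)
    fix e :: real assume e: "0 < e"
    have "e / (P d + 1) * P d \<le> e" using P e by (simp add: field_simps)
    then show "F d \<le> F c + S * (V d - V c) + e" using key[of "e / (P d + 1)"] P e by simp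
  qed
  then show ?thesis by (simp add: F_def R_def gd)
qed

context half_linear begin

text \<open>A positive flux at \<open>c\<close> stays positive nearby and makes \<open>v\<close>
  strictly larger just to the right of \<open>c\<close>.\<close>

lemma sol_vanish_flux_le:
  assumes s: "sol lam v z" and cd: "0 \<le> c" "c < d" "d \<le> L" and v: "\<And>x. x \<in> {c..d} \<Longrightarrow> v x = 0"
  shows "z c \<le> 0"
proof (rule ccontr)
  assume "\<not> z c \<le> 0"
  then have z: "0 < z c" by simp
  have cL: "c \<in> {0..L}" using cd by auto
  obtain \<delta> where dl: "0 < \<delta>" "\<And>x. x \<in> {0..L} \<Longrightarrow> dist x c < \<delta> \<Longrightarrow> dist (z x) (z c) < z c / 2"
    using solD(4)[OF s] cL half_gt_zero[OF z] unfolding continuous_on_iff by meson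
  define r where "r = min \<delta> (d - c) / 2"
  have r: "0 < r" "r < \<delta>" "r < d - c" using dl(1) cd by (auto simp: r_def min_def)
  have "(z c / 2) powr (1 / (p - 1)) * integral {c..c + r} \<sigma> \<le> v (c + r) - v c"
  proof (rule sol_u_lower[OF s])
    fix t assume "t \<in> {c..c + r}"
    then have "dist (z t) (z c) < z c / 2" by (intro dl(2)) (use r cd in \<open>auto simp: dist_real_def\<close>)
    then show "z c / 2 \<le> z t" unfolding dist_real_def by linarith
  qed (use r cd z in auto)
  moreover have "0 < (z c / 2) powr (1 / (p - 1)) * integral {c..c + r} \<sigma>"
    using z integral_\<sigma>_pos[of c "c + r"] r cd by simp
  ultimately show False using v[of c] v[of "c + r"] r cd by simp
qed

lemma sol_vanish_flux:
  assumes s: "sol lam u w" and cd: "0 \<le> c" "c < d" "d \<le> L" and u: "\<And>x. x \<in> {c..d} \<Longrightarrow> u x = 0"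
  shows "w c = 0"
  using sol_vanish_flux_le[OF s cd u] sol_vanish_flux_le[OF sol_uminus[OF s] cd] u by fastforce

text \<open>Integrating \<open>(u w)'\<close> between two zeros balances the energy against
  \<open>lam\<close> times the integral of \<open>\<rho> |u| powr p\<close>. Jensen's inequality
  bounds one side below, the variation of \<open>|u| powr p\<close> bounds the other above, and the
  common factor \<open>U powr p\<close> cancels.\<close>

lemma lyapunov_inequality:
  assumes s: "sol lam u w" and lam: "0 < lam" and cd: "0 \<le> c" "c < d" "d \<le> L"
    and u: "u c = 0" "u d = 0" and nz: "\<exists>x\<in>{0..L}. u x \<noteq> 0"
    and S: "\<And>x. x \<in> {c..d} \<Longrightarrow> \<bar>integral {c..x} \<rho>\<bar> \<le> S"
  shows "integral {c..d} \<sigma> powr (1 - p) \<le> lam * p * S"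
proof -
  have sub: "{c..d} \<subseteq> {0..L}" and cd': "c \<le> d" using cd by auto
  define A where "A = integral {c..d} \<sigma>"
  have A: "0 < A" unfolding A_def by (rule integral_\<sigma>_pos[OF cd])
  define h where "h = (\<lambda>t. \<psi> (w t) * \<sigma> t)"
  have habs: "h absolutely_integrable_on {c..d}"
    unfolding h_def using sol_u_diff(1)[OF s cd(1) cd' cd(3)] .
  have hi: "(\<lambda>t. \<bar>h t\<bar>) integrable_on {x..y}" "h integrable_on {x..y}" if "c \<le> x" "y \<le> d" for x y
  proof -
    have "h absolutely_integrable_on {x..y}" by (rule set_integrable_subset[OF habs]) (use that in auto)
    then show "(\<lambda>t. \<bar>h t\<bar>) integrable_on {x..y}" "h integrable_on {x..y}" 
      by (auto simp: absolutely_integrable_on_def)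
  qed
  define V where "V x = integral {c..x} (\<lambda>t. \<bar>h t\<bar>)" for x
  define U where "U = V d"
  have Vd: "V y - V x = integral {x..y} (\<lambda>t. \<bar>h t\<bar>)" if "c \<le> x" "x \<le> y" "y \<le> d" for x y
    using Henstock_Kurzweil_Integration.integral_combine[of c x y "\<lambda>t. \<bar>h t\<bar>"] that hi[of c y] by (simp add: V_def)
  have du: "\<bar>u y - u x\<bar> \<le> V y - V x" if xy: "c \<le> x" "x \<le> y" "y \<le> d" for x y
  proof -
    have "u y - u x = integral {x..y} h"
      using sol_u_diff(2)[OF s, of x y] xy cd by (simp add: h_def)
    also have "norm \<dots> \<le> integral {x..y} (\<lambda>t. \<bar>h t\<bar>)"
      by (rule integral_norm_bound_integral) (use hi xy in auto)
    finally show ?thesis using Vd[OF xy] by simp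
  qed
  have Vmono: "V x \<le> V y" if "c \<le> x" "x \<le> y" "y \<le> d" for x y using du[OF that] by linarith
  have V0: "V c = 0" by (simp add: V_def)
  have uU: "\<bar>u x\<bar> \<le> U" if "x \<in> {c..d}" for x
    using du[of c x] Vmono[of x d] that u(1) V0 by (simp add: U_def)
  \<comment> \<open>Zero variation would make \<open>u\<close> vanish on the interval, hence also
    the flux at \<open>c\<close>, and uniqueness would make \<open>u\<close> trivial.\<close>
  have U: "0 < U"
  proof (rule ccontr)
    assume "\<not> 0 < U"
    then have u0: "u x = 0" if "x \<in> {c..d}" for x using uU[OF that] by linarith
    have cL: "c \<in> {0..L}" using cd by auto
    have "w c = 0" by (rule sol_vanish_flux[OF s cd u0])
    then show False using sol_unique_zero[OF s cL u(1)] nz by blast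
  qed
  define g where "g x = \<bar>u x\<bar> powr p" for x
  have cu: "continuous_on {c..d} u" by (rule continuous_on_subset[OF solD(3)[OF s] sub])
  have cg: "continuous_on {c..d} g"
    unfolding g_def using p by (intro continuous_on_powr' continuous_intros cu) auto
  \<comment> \<open>By the mean value theorem on \<open>[-U, U]\<close>, the increments of
    \<open>|u| powr p\<close> are at most \<open>p * U powr (p - 1)\<close> times those of
    \<open>V\<close>.\<close>
  have dg: "\<bar>g y - g x\<bar> \<le> p * U powr (p - 1) * V y - p * U powr (p - 1) * V x"
    if xy: "c \<le> x" "x \<le> y" "y \<le> d" for x y
  proof -
    have "norm (\<bar>u y\<bar> powr p - \<bar>u x\<bar> powr p) \<le> p * U powr (p - 1) * norm (u y - u x)"
    proof (rule field_differentiable_bound[of "{-U..U}" "\<lambda>t. \<bar>t\<bar> powr p" "\<lambda>t. p * signed_pow p t"])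
      show "((\<lambda>t. \<bar>t\<bar> powr p) has_real_derivative p * signed_pow p t) (at t within {-U..U})" for t
        by (rule has_field_derivative_at_within[OF DERIV_abs_powr[OF p]])
      show "norm (p * signed_pow p t) \<le> p * U powr (p - 1)" if "t \<in> {-U..U}" for t
        using that p by (auto simp: abs_mult abs_signed_pow intro!: powr_mono2)
      show "u y \<in> {-U..U}" "u x \<in> {-U..U}" using uU[of x] uU[of y] xy by (auto simp: abs_le_iff)
    qed auto
    also have "\<dots> \<le> p * U powr (p - 1) * (V y - V x)"
      using du[OF xy] p by (intro mult_left_mono) auto
    finally show ?thesis by (simp add: g_def right_diff_distrib)
  qed
  have \<rho>: "\<rho> absolutely_integrable_on {c..d}" using subinterval_integrable(2) cd by simp
  have "integral {c..d} (\<lambda>x. g x * \<rho> x) \<le> S * (p * U powr (p - 1) * V d - p * U powr (p - 1) * V c)"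
    by (rule integral_mult_le_variation[OF cd' \<rho> cg _ S dg]) (use u p in \<open>auto simp: g_def\<close>)
  also have "\<dots> = p * S * U powr p"
    using U powr_add[of U "p - 1" 1] by (simp add: V0 U_def[symmetric])
  finally have upper: "integral {c..d} (\<lambda>x. g x * \<rho> x) \<le> p * S * U powr p" .
  \<comment> \<open>The mean of \<open>|\<psi> (w t)|\<close> with respect to the weight
    \<open>\<sigma>\<close>. Taking the tangent line of \<open>t powr p\<close> at this mean is the
    usual proof of Jensen's inequality.\<close>
  define m where "m = U / A"
  have m: "0 < m" using U A by (simp add: m_def)
  \<comment> \<open>A minorant of the derivative of \<open>u w\<close>: the convex power
    \<open>|\<psi> (w t)| powr p\<close> is replaced by its tangent line at \<open>m\<close>, then
    multiplied by \<open>\<sigma>\<close>.\<close>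
  define k where "k t = p * m powr (p - 1) * \<bar>h t\<bar> - (p - 1) * m powr p * \<sigma> t - lam * (g t * \<rho> t)" for t
  have gi: "(\<lambda>t. g t * \<rho> t) integrable_on {c..d}"
    using absolutely_integrable_continuous_mult[OF cg \<rho>] by (simp add: absolutely_integrable_on_def)
  have \<sigma>i: "\<sigma> integrable_on {c..d}" using subinterval_integrable(3) cd by simp
  have ki: "(k has_integral (p * m powr (p - 1) * U - (p - 1) * m powr p * A - lam * integral {c..d} (\<lambda>t. g t * \<rho> t))) {c..d}"
    unfolding k_def U_def V_def A_def
    by (intro has_integral_diff has_integral_mult_right integrable_integral hi gi \<sigma>i) auto
  have "integral {c..d} k \<le> u d * w d - u c * w c"
  proof (rule abs_cont_on_integral_le[OF cd'])
    show "abs_cont_on {c..d} (\<lambda>x. u x * w x)"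
      by (intro abs_cont_on_mult abs_cont_on_subset[OF solD(1)[OF s] sub] abs_cont_on_subset[OF solD(2)[OF s] sub])
    show "k integrable_on {c..d}" using ki by blast
    have "AE x in lebesgue. x \<in> {0<..<L} \<longrightarrow>
        (u has_real_derivative \<psi> (w x) * \<sigma> x) (at x) \<and>
        (w has_real_derivative - (lam * \<rho> x * signed_pow p (u x))) (at x)" using s by (simp add: sol_def)
    then show "AE x in lebesgue. x \<in> {c<..<d} \<longrightarrow>
       (\<exists>f'. ((\<lambda>x. u x * w x) has_real_derivative f') (at x) \<and> k x \<le> f')"
    proof eventually_elim
      case (elim x)
      show ?case
      proof
        assume "x \<in> {c<..<d}"
        then have x: "x \<in> {0<..<L}" using cd by auto
        let ?D = "\<psi> (w x) * \<sigma> x * w x + - (lam * \<rho> x * signed_pow p (u x)) * u x"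
        have "((\<lambda>x. u x * w x) has_real_derivative ?D) (at x)"
          using elim x by (intro DERIV_mult) auto
        moreover have "k x \<le> ?D"
        proof -
          have "\<psi> (w x) * w x = \<bar>\<psi> (w x)\<bar> powr p" using mult_signed_pow[of "\<psi> (w x)" p] by (simp add: signed_pow_\<psi>)
          moreover have "signed_pow p (u x) * u x = g x" using mult_signed_pow[of "u x" p] by (simp add: g_def mult.commute)
          ultimately have D: "?D = \<bar>\<psi> (w x)\<bar> powr p * \<sigma> x - lam * (g x * \<rho> x)"
            by (simp add: mult_ac)
          have "p * (\<bar>\<psi> (w x)\<bar> * m powr (p - 1)) \<le> \<bar>\<psi> (w x)\<bar> powr p + (p - 1) * m powr p"
            by (rule Young_powr) (use p m in auto)
          then have "(p * m powr (p - 1) * \<bar>\<psi> (w x)\<bar> - (p - 1) * m powr p) * \<sigma> x \<le> \<bar>\<psi> (w x)\<bar> powr p * \<sigma> x"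
            using \<sigma>_nonneg by (intro mult_right_mono) (auto simp: mult_ac)
          then show ?thesis unfolding D k_def h_def using \<sigma>_nonneg[of x]
            by (simp add: abs_mult left_diff_distrib mult.assoc)
        qed
        ultimately show "\<exists>f'. ((\<lambda>x. u x * w x) has_real_derivative f') (at x) \<and> k x \<le> f'" by blast
      qed
    qed
  qed
  then have "p * m powr (p - 1) * U - (p - 1) * m powr p * A \<le> lam * integral {c..d} (\<lambda>t. g t * \<rho> t)"
    using integral_unique[OF ki] u by simp
  also have "\<dots> \<le> lam * (p * S * U powr p)" using upper lam by (intro mult_left_mono) auto
  finally have le: "p * m powr (p - 1) * U - (p - 1) * m powr p * A \<le> lam * p * S * U powr p" by (simp add: mult_ac)
  \<comment> \<open>At the mean the tangent terms combine to \<open>m powr p * A\<close>, which is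
    \<open>A powr (1 - p) * U powr p\<close>.\<close>
  have UmA: "U = m * A" using A by (simp add: m_def)
  have mp: "m powr (p - 1) * m = m powr p" using m powr_add[of m "p - 1" 1] by simp
  have "p * m powr (p - 1) * U = p * (m powr (p - 1) * m) * A" unfolding UmA by (simp add: mult_ac)
  then have pm: "p * m powr (p - 1) * U = p * m powr p * A" unfolding mp .
  have "m powr p * A \<le> lam * p * S * U powr p" using le unfolding pm by (simp add: algebra_simps)
  moreover have "m powr p * A = A powr (1 - p) * U powr p"
    using A U by (simp add: m_def powr_divide powr_diff)
  ultimately have "A powr (1 - p) * U powr p \<le> lam * p * S * U powr p" by simp
  then show ?thesis using U by (simp add: A_def)
qed

section \<open>Counting zeros of eigenfunctions\<close>

definition dirichlet_eigenfunction :: "real \<Rightarrow> (real \<Rightarrow> real) \<Rightarrow> bool" where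
  "dirichlet_eigenfunction lam u \<longleftrightarrow>
     (\<exists>w. sol lam u w) \<and> u 0 = 0 \<and> u L = 0 \<and> (\<exists>x\<in>{0..L}. u x \<noteq> 0)"

text \<open>Induction that adds the largest element of \<open>E\<close> last: Sturm comparison puts
  a zero of the new eigenfunction strictly inside each gap of the previous one, and with the
  endpoints 0 and \<open>L\<close> this makes one more gap.\<close>

lemma eigenfunction_zeros:
  assumes "finite E" "E \<noteq> {}" "\<And>\<mu>. \<mu> \<in> E \<Longrightarrow> 0 < \<mu> \<and> (\<exists>u. dirichlet_eigenfunction \<mu> u)"
    and "dirichlet_eigenfunction (Max E) v"
  shows "\<exists>x. x 0 = 0 \<and> x (card E) = L \<and> (\<forall>i<card E. x i < x (Suc i)) \<and> (\<forall>i\<le>card E. v (x i) = 0)"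
  using assms
proof (induction E arbitrary: v rule: finite_linorder_max_induct)
  case empty then show ?case by simp
next
  case (insert b A)
  have Max: "Max (insert b A) = b" using insert.hyps by (intro Max_eqI) auto
  have card: "card (insert b A) = Suc (card A)" using insert.hyps by auto
  have v: "v 0 = 0" "v L = 0" and b: "0 < b"
    using insert.prems Max by (auto simp: dirichlet_eigenfunction_def)
  obtain z where z: "sol b v z" using insert.prems Max by (auto simp: dirichlet_eigenfunction_def)
  show ?case
  proof (cases "A = {}")
    case True
    then show ?thesis using v L by (intro exI[of _ "\<lambda>i. if i = 0 then 0 else L"]) (auto simp: le_Suc_eq)
  next
    case False
    have MA: "Max A \<in> A" using False insert.hyps by simp
    then obtain u where u: "dirichlet_eigenfunction (Max A) u" using insert.prems(2) by blast
    obtain x where x: "x 0 = 0" "x (card A) = L" "\<And>i. i < card A \<Longrightarrow> x i < x (Suc i)" "\<And>i. i \<le> card A \<Longrightarrow> u (x i) = 0"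
      using insert.IH[OF False _ u] insert.prems(2) by auto
    obtain w where w: "sol (Max A) u w" "\<exists>x\<in>{0..L}. u x \<noteq> 0" using u by (auto simp: dirichlet_eigenfunction_def)
    have mono: "x i \<le> x j" if "i \<le> j" "j \<le> card A" for i j
      using strict_chain_le[of _ x] x(3) that by blast
    have "\<exists>y. x i < y \<and> y < x (Suc i) \<and> v y = 0" if i: "i < card A" for i
    proof (rule sturm[OF w(1) z])
      show "0 \<le> x i" "x (Suc i) \<le> L" using mono[of 0 i] mono[of "Suc i" "card A"] x(1,2) i by auto
    qed (use i x w(2) insert MA in auto)
    then obtain y where y: "\<And>i. i < card A \<Longrightarrow> x i < y i \<and> y i < x (Suc i) \<and> v (y i) = 0" by metis
    \<comment> \<open>The interior zeros \<open>y 0, ..., y (card A - 1)\<close> are shifted by one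
      to make room for 0 in front; \<open>L\<close> comes last.\<close>
    define Y where "Y i = (if i = 0 then 0 else if i = Suc (card A) then L else y (i - 1))" for i
    have cA: "0 < card A" using False insert.hyps by (simp add: card_gt_0_iff)
    have "Y i < Y (Suc i)" if i: "i < Suc (card A)" for i
    proof -
      consider "i = 0" | j where "i = Suc j" "Suc j < card A" | j where "i = Suc j" "Suc j = card A"
        using i by (cases i) (auto simp: less_Suc_eq)
      then show ?thesis
      proof cases
        case 1 then show ?thesis using y[of 0] cA x(1) by (auto simp: Y_def)
      next
        case 2
        then have "y j < x (Suc j)" "x (Suc j) < y (Suc j)" using y[of j] y[of "Suc j"] by auto
        then show ?thesis using 2 by (simp add: Y_def)
      next
        case 3
        have "Y i = y j" "Y (Suc i) = L" by (simp_all add: Y_def 3(1) 3(2)[symmetric])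
        moreover have "y j < x (card A)" using y[of j] 3(2) by auto
        ultimately show ?thesis using x(2) by simp
      qed
    qed
    moreover have "v (Y i) = 0" if "i \<le> Suc (card A)" for i
      using that v y[of "i - 1"] by (auto simp: Y_def le_Suc_eq)
    ultimately show ?thesis unfolding card by (intro exI[of _ Y]) (auto simp: Y_def)
  qed
qed

text \<open>The Lyapunov inequality is used on a single gap, one whose \<open>\<sigma>\<close>-mass
  is at most the average \<open>A / n\<close>.\<close>

lemma eigenvalue_lower_bound:
  assumes s: "sol lam u w" and lam: "0 < lam" and nz: "\<exists>x\<in>{0..L}. u x \<noteq> 0"
    and n: "0 < n" and x: "x 0 = 0" "x n = L" "\<And>i. i < n \<Longrightarrow> x i < x (Suc i)" "\<And>i. i \<le> n \<Longrightarrow> u (x i) = 0"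
    and S: "\<And>c d. 0 \<le> c \<Longrightarrow> c < d \<Longrightarrow> d \<le> L \<Longrightarrow> \<bar>integral {c..d} \<rho>\<bar> \<le> S"
  shows "real n powr (p - 1) / p * integral {0..L} \<sigma> powr (1 - p) \<le> lam * S"
proof -
  have mono: "x i \<le> x j" if "i \<le> j" "j \<le> n" for i j
    using strict_chain_le[of _ x] x(3) that by blast
  have xL: "0 \<le> x i" "x i \<le> L" if "i \<le> n" for i using mono[of 0 i] mono[of i n] x(1,2) that by auto
  define A where "A = integral {0..L} \<sigma>"
  have A: "0 < A" unfolding A_def using integral_\<sigma>_pos[of 0 L] L by simp
  have "(\<Sum>i<m. integral {x i..x (Suc i)} \<sigma>) = integral {0..x m} \<sigma>" if "m \<le> n" for m
    using that
  proof (induction m)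
    case 0 then show ?case by (simp add: x)
  next
    case (Suc m)
    have "integral {0..x m} \<sigma> + integral {x m..x (Suc m)} \<sigma> = integral {0..x (Suc m)} \<sigma>"
      by (rule Henstock_Kurzweil_Integration.integral_combine)
        (use xL[of m] xL[of "Suc m"] mono[of m "Suc m"] Suc.prems subinterval_integrable(3) in auto)
    then show ?case using Suc by simp
  qed
  then have sum: "(\<Sum>i<n. integral {x i..x (Suc i)} \<sigma>) = A" by (simp add: A_def x)
  have "\<exists>i<n. integral {x i..x (Suc i)} \<sigma> \<le> A / real n"
  proof (rule ccontr)
    assume "\<not> ?thesis"
    then have "(\<Sum>i<n. A / real n) < (\<Sum>i<n. integral {x i..x (Suc i)} \<sigma>)"
      using n by (intro sum_strict_mono) auto
    then show False using sum n by simp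
  qed
  then obtain i where i: "i < n" "integral {x i..x (Suc i)} \<sigma> \<le> A / real n" by blast
  have xi: "0 \<le> x i" "x i < x (Suc i)" "x (Suc i) \<le> L" using xL[of i] xL[of "Suc i"] x(3)[of i] i by auto
  have S0: "0 \<le> S" using S[of 0 L] L by simp
  \<comment> \<open>The bound \<open>S\<close> is assumed for nondegenerate intervals; at
    \<open>y = x i\<close> the integral is 0 and \<open>0 \<le> S\<close> suffices.\<close>
  have "\<bar>integral {x i..y} \<rho>\<bar> \<le> S" if "y \<in> {x i..x (Suc i)}" for y
    using S[of "x i" y] xi that S0 by (cases "y = x i") auto
  then have "integral {x i..x (Suc i)} \<sigma> powr (1 - p) \<le> lam * p * S"
    using x(4) i by (intro lyapunov_inequality[OF s lam xi _ _ nz]) auto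
  \<comment> \<open>The exponent \<open>1 - p\<close> is negative, so the upper bound on the mass
    becomes a lower bound on its power.\<close>
  moreover have "(A / real n) powr (1 - p) \<le> integral {x i..x (Suc i)} \<sigma> powr (1 - p)"
    using p i(2) integral_\<sigma>_pos[OF xi] by (intro powr_mono2') auto
  moreover have "(A / real n) powr (1 - p) = real n powr (p - 1) * A powr (1 - p)"
    using A n powr_minus[of "real n" "p - 1"] by (simp add: powr_divide field_simps)
  ultimately have "real n powr (p - 1) * A powr (1 - p) \<le> lam * S * p" by (simp add: mult_ac)
  then show ?thesis using p by (simp add: A_def field_simps)
qed

end

section \<open>Transfer to the original Dirichlet problem\<close>

theorem theorem1p2:
  fixes p L lam :: real and a \<rho> :: "real \<Rightarrow> real" and k :: nat
  assumes "1 < p" and "0 < L"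
    and "muckenhoupt p a"
    and "\<rho> absolutely_integrable_on {0..L}"
    and "1 \<le> k"
    and "kth_positive_eigenvalue p L a \<rho> k lam"
  shows "real k powr (p - 1) / p * integral {0..L} (\<lambda>t. a t powr (- 1 / (p - 1))) powr (1 - p)
    \<le> lam * (SUP (c, d)\<in>{(c, d). 0 \<le> c \<and> c < d \<and> d \<le> L}. \<bar>integral {c..d} \<rho>\<bar>)"
proof -
  have apos: "AE x in lebesgue. 0 < a x" using assms(3) by (simp add: muckenhoupt_def)
  interpret half_linear p L "\<lambda>t. a t powr (- 1 / (p - 1))" \<rho>
  proof
    show "AE x in lebesgue. 0 < a x powr (- 1 / (p - 1))"
      using apos by eventually_elim simp
  qed (use assms in \<open>auto simp: muckenhoupt_def\<close>)
  \<comment> \<open>Wherever \<open>a\<close> is positive, the flux relation can be solved for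
    \<open>u'\<close>; this turns the equation into the first-order system for \<open>u\<close> and
    \<open>w\<close>.\<close>
  have sol: "\<exists>w. sol \<mu> u w" if u: "dirichlet_solution p L a \<rho> \<mu> u" for \<mu> u
  proof -
    obtain w where w: "abs_cont_on {0..L} u" "abs_cont_on {0..L} w"
      "AE x in lebesgue. x \<in> {0<..<L} \<longrightarrow>
           (\<exists>u' w'. (u has_real_derivative u') (at x) \<and> (w has_real_derivative w') (at x) \<and>
              w x = a x * signed_pow p u' \<and> - w' = \<mu> * \<rho> x * signed_pow p (u x))"
      using u unfolding dirichlet_solution_def by blast
    from w(3) apos have "AE x in lebesgue. x \<in> {0<..<L} \<longrightarrow>
        (u has_real_derivative \<psi> (w x) * a x powr (- 1 / (p - 1))) (at x) \<and>
        (w has_real_derivative - (\<mu> * \<rho> x * signed_pow p (u x))) (at x)"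
    proof eventually_elim
      case (elim x)
      show ?case
      proof
        assume "x \<in> {0<..<L}"
        then obtain u' w' where d: "(u has_real_derivative u') (at x)" "(w has_real_derivative w') (at x)"
          "w x = a x * signed_pow p u'" "- w' = \<mu> * \<rho> x * signed_pow p (u x)" using elim by blast
        have "u' = \<psi> (w x) * a x powr (- 1 / (p - 1))"
          by (rule signed_pow_inverse[OF assms(1) elim(2) d(3)])
        moreover have "w' = - (\<mu> * \<rho> x * signed_pow p (u x))" using d(4) by simp
        ultimately show "(u has_real_derivative \<psi> (w x) * a x powr (- 1 / (p - 1))) (at x) \<and>
        (w has_real_derivative - (\<mu> * \<rho> x * signed_pow p (u x))) (at x)" using d(1,2) by metis
      qed
    qed
    then show ?thesis using w(1,2) unfolding sol_def by blast
  qed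
  have eig: "\<exists>u. dirichlet_eigenfunction \<mu> u" if "eigenvalue p L a \<rho> \<mu>" for \<mu>
  proof -
    obtain u where u: "dirichlet_solution p L a \<rho> \<mu> u" "\<exists>x\<in>{0..L}. u x \<noteq> 0"
      using \<open>eigenvalue p L a \<rho> \<mu>\<close> unfolding eigenvalue_def by blast
    have "u 0 = 0" "u L = 0" using u(1) unfolding dirichlet_solution_def by auto
    then show ?thesis using sol[OF u(1)] u(2) unfolding dirichlet_eigenfunction_def by blast
  qed
  define E where "E = {\<mu>. 0 < \<mu> \<and> \<mu> \<le> lam \<and> eigenvalue p L a \<rho> \<mu>}"
  have E: "finite E" "card E = k" "0 < lam" "lam \<in> E"
    using assms(6) unfolding kth_positive_eigenvalue_def E_def by auto
  \<comment> \<open>\<open>E\<close> has exactly \<open>k\<close> elements and \<open>lam\<close> is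
    the largest, so the zero count of its eigenfunction is governed by \<open>k\<close>.\<close>
  have Max: "Max E = lam" using E by (intro Max_eqI) (auto simp: E_def)
  obtain u where u: "dirichlet_eigenfunction lam u" using eig[of lam] E(4) by (auto simp: E_def)
  obtain w where w: "sol lam u w" "\<exists>x\<in>{0..L}. u x \<noteq> 0" using u unfolding dirichlet_eigenfunction_def by blast
  have "\<exists>x. x 0 = 0 \<and> x (card E) = L \<and> (\<forall>i<card E. x i < x (Suc i)) \<and> (\<forall>i\<le>card E. u (x i) = 0)"
  proof (rule eigenfunction_zeros[OF E(1)])
    show "0 < \<mu> \<and> (\<exists>u. dirichlet_eigenfunction \<mu> u)" if "\<mu> \<in> E" for \<mu>
      using eig[of \<mu>] that unfolding E_def by blast
  qed (use u Max E(4) in auto)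
  then obtain x where x: "x 0 = 0" "x k = L" "\<And>i. i < k \<Longrightarrow> x i < x (Suc i)" "\<And>i. i \<le> k \<Longrightarrow> u (x i) = 0"
    unfolding E(2) by blast
  show ?thesis
  proof (rule eigenvalue_lower_bound[OF w(1) E(3) w(2) _ x])
    show "0 < k" using assms(5) by simp
    fix c d :: real assume cd: "0 \<le> c" "c < d" "d \<le> L"
    \<comment> \<open>The integral of \<open>|\<rho>|\<close> bounds the family from above, which
      makes the real supremum an actual upper bound.\<close>
    have "\<bar>integral {c..d} \<rho>\<bar> \<le> integral {0..L} (\<lambda>t. \<bar>\<rho> t\<bar>)" if "0 \<le> c" "d \<le> L" for c d
    proof -
      have "norm (integral {c..d} \<rho>) \<le> integral {c..d} (\<lambda>t. \<bar>\<rho> t\<bar>)"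
        by (rule integral_norm_bound_integral) (use subinterval_integrable[OF that] in auto)
      also have "\<dots> \<le> integral {0..L} (\<lambda>t. \<bar>\<rho> t\<bar>)" by (rule subinterval_integral_mono) (use that in auto)
      finally show ?thesis by simp
    qed
    then have "bdd_above ((\<lambda>(c, d). \<bar>integral {c..d} \<rho>\<bar>) ` {(c, d). 0 \<le> c \<and> c < d \<and> d \<le> L})"
      by (intro bdd_aboveI2[of _ _ "integral {0..L} (\<lambda>t. \<bar>\<rho> t\<bar>)"]) auto
    from cSUP_upper[OF _ this, of "(c, d)"] cd
    show "\<bar>integral {c..d} \<rho>\<bar> \<le> (SUP (c, d)\<in>{(c, d). 0 \<le> c \<and> c < d \<and> d \<le> L}. \<bar>integral {c..d} \<rho>\<bar>)"
      by simp
  qed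
qed

end
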